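(* Let $G<{\rm GL}_+(2,\mathbb{R})$ be a finite subgroup without contracting elements. Then there exists an infinite superelliptic curve $S(f)$, with its tame translation structure, whose Veech group is $\Gamma(S(f))=G$.
   Context: A matrix $A\in{\rm GL}_+(2,\mathbb{R})$ (real $2\times 2$ matrices with positive determinant) is contracting if $|A\cdot v|<|v|$ for all $v\in\mathbb{C}\setminus\{0\}$, where $\mathbb{C}$ is identified with $\mathbb{R}^2$. Weierstrass map: for a sequence $(z_k)_{k\in\mathbb{N}}$ of distinct complex numbers with $|z_k|\to\infty$, a function $f(z)=h(z)z^{m}\prod_{k\ge 1,\,z_k\ne 0}\left(1-\frac{z}{z_k}\right)E_k(z)$, where $h$ is a zero-free entire function, $m=1$ if some $z_k=0$ and $m=0$ otherwise, and $E_k(z)=\exp\left[\sum_{s=1}^{d(k)}\frac1s\left(\frac{z}{z_k}\right)^s\right]$ with suitably large non-negative integers $d(k)$ (so that the product converges). Its zeros are simple and are exactly the points $z_k$. For such $f$ and an integer $n\ge2$, the Riemann surface $S(f)=\{(z,w)\in\mathbb{C}^2: w^n=f(z)\}$ is called an infinite superelliptic curve. Translation structure on $S(f)$: let $p_{\mathbf z}:S(f)\to\mathbb{C}$, $(z,w)\mapsto z$. The restriction $p_{\mathbf z}: S(f)\setminus\{(z_k,0):k\in\mathbb{N}\}\to\mathbb{C}\setminus\{z_k:k\in\mathbb{N}\}$ is an unramified covering of degree $n$, by which the standard translation structure of $\mathbb{C}\setminus\{z_k:k\in\mathbb{N}\}$ is pulled back; the cone points of $S(f)$ are exactly the points $(z_k,0)$.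 Veech group: an affine diffeomorphism $T:S\to S$ of a translation surface is a homeomorphism sending cone points to cone points which in the local coordinates of the translation atlas is a real-affine map $z\mapsto A\cdot z+t$ with $A\in{\rm GL}(2,\mathbb{R})$, $t\in\mathbb{C}$. ${\rm Aff}_+(S)$ is the group of orientation preserving affine diffeomorphisms of $S$. The differential of $T\in{\rm Aff}_+(S)$ is a constant matrix $D(T)\in{\rm GL}_+(2,\mathbb{R})$, and $D:{\rm Aff}_+(S)\to{\rm GL}_+(2,\mathbb{R})$ is a group homomorphism whose image $\Gamma(S)$ is the Veech group of $S$. *)

theory Defs
  imports
    "HOL-Complex_Analysis.Complex_Analysis"
    "HOL-Algebra.Group"
begin

section \<open>Plane linear maps\<close>

definition GL :: "(real^2^2) set" where
  "GL = {A. det A \<noteq> 0}"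

definition GL_plus :: "(real^2^2) monoid" where
  "GL_plus = \<lparr>carrier = {A. 0 < det A}, mult = (**), one = mat 1\<rparr>"

text \<open>The action on \<open>\<complex>\<close>, identified with \<open>\<real>\<^sup>2\<close> through real and imaginary part.\<close>

definition act :: "real^2^2 \<Rightarrow> complex \<Rightarrow> complex" (infixr \<open>\<bullet>\<^sub>c\<close> 75) where
  "A \<bullet>\<^sub>c v = (let u = A *v vector [Re v, Im v] in Complex (u $ 1) (u $ 2))"

definition contracting :: "real^2^2 \<Rightarrow> bool" where
  "contracting A \<longleftrightarrow> (\<forall>v. v \<noteq> 0 \<longrightarrow> norm (A \<bullet>\<^sub>c v) < norm v)"

section \<open>Translation surfaces and their Veech groups\<close>

text \<open>
  The charts form a translation atlas of the complement of the cone points. A chart is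
  a domain together with a coordinate function, whose values off the domain are irrelevant.
\<close>

type_synonym 'a chart = "'a set \<times> ('a \<Rightarrow> complex)"

record 'a translation_surface =
  points :: "'a set"
  cone_points :: "'a set"
  charts :: "'a chart set"

definition regular_points :: "'a translation_surface \<Rightarrow> 'a set" where
  "regular_points S = points S - cone_points S"

text \<open>
  In all local coordinates around \<open>x\<close> and \<open>T x\<close>, the map \<open>T\<close> is \<open>z \<mapsto> A \<bullet>\<^sub>c z + t\<close> near \<open>x\<close>.
  Only \<open>t\<close> depends on the coordinates, since transition maps are translations.
\<close>

definition affine_at ::
  "'a::topological_space translation_surface \<Rightarrow> real^2^2 \<Rightarrow> ('a \<Rightarrow> 'a) \<Rightarrow> 'a \<Rightarrow> bool" where
  "affine_at S A T x \<longleftrightarrow>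
     (\<forall>(U, \<phi>) \<in> charts S. \<forall>(V, \<psi>) \<in> charts S. x \<in> U \<and> T x \<in> V \<longrightarrow>
        (\<exists>W t. openin (top_of_set U) W \<and> x \<in> W \<and> T ` W \<subseteq> V \<and>
               (\<forall>y\<in>W. \<psi> (T y) = A \<bullet>\<^sub>c \<phi> y + t)))"

text \<open>The linear part is allowed to vary from point to point here.\<close>

definition affine_diffeo ::
  "'a::topological_space translation_surface \<Rightarrow> ('a \<Rightarrow> 'a) \<Rightarrow> bool" where
  "affine_diffeo S T \<longleftrightarrow>
     (\<exists>T'. homeomorphism (points S) (points S) T T') \<and>
     T ` cone_points S = cone_points S \<and>
     (\<forall>x \<in> regular_points S. \<exists>A \<in> GL. affine_at S A T x)"

definition orientation_preserving ::
  "'a::topological_space translation_surface \<Rightarrow> ('a \<Rightarrow> 'a) \<Rightarrow> bool" where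
  "orientation_preserving S T \<longleftrightarrow>
     (\<forall>x \<in> regular_points S. \<exists>A \<in> carrier GL_plus. affine_at S A T x)"

definition Aff_plus :: "'a::topological_space translation_surface \<Rightarrow> ('a \<Rightarrow> 'a) set" where
  "Aff_plus S = {T. affine_diffeo S T \<and> orientation_preserving S T}"

text \<open>
  The constant linear part. It is well defined for affine diffeomorphisms when the regular
  points form a connected non-empty surface.
\<close>

definition differential ::
  "'a::topological_space translation_surface \<Rightarrow> ('a \<Rightarrow> 'a) \<Rightarrow> real^2^2" where
  "differential S T = (THE A. \<forall>x \<in> regular_points S. affine_at S A T x)"

definition Veech_group :: "'a::topological_space translation_surface \<Rightarrow> (real^2^2) set" where
  "Veech_group S = differential S ` Aff_plus S"

section \<open>Weierstrass maps\<close>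

text \<open>
  The product is required to converge in the strict sense at every point (the product of
  the non-zero factors does not diverge to zero), and locally uniformly.
  With \<open>weierstrass_factor d u = (1 - u) * exp (\<Sum>s=1..d. u ^ s / s)\<close>, the factor at \<open>k\<close> is
  \<open>(1 - z / z\<^sub>k) * E\<^sub>k(z)\<close>.
\<close>

definition weierstrass_term :: "(nat \<Rightarrow> complex) \<Rightarrow> (nat \<Rightarrow> nat) \<Rightarrow> nat \<Rightarrow> complex \<Rightarrow> complex" where
  "weierstrass_term zs d k z =
     (if zs k = 0 then 1 else weierstrass_factor (d k) (z / zs k))"

definition weierstrass_map :: "(nat \<Rightarrow> complex) \<Rightarrow> (complex \<Rightarrow> complex) \<Rightarrow> bool" where
  "weierstrass_map zs f \<longleftrightarrow>
     inj zs \<and> filterlim (\<lambda>k. norm (zs k)) at_top sequentially \<and>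
     (\<exists>h d. h holomorphic_on UNIV \<and> (\<forall>z. h z \<noteq> 0) \<and>
        (\<forall>z. convergent_prod (\<lambda>k. weierstrass_term zs d k z)) \<and>
        (\<forall>K. compact K \<longrightarrow>
           uniformly_convergent_on K (\<lambda>N z. \<Prod>k<N. weierstrass_term zs d k z)) \<and>
        (\<forall>z. f z = h z * z ^ (if 0 \<in> range zs then 1 else 0) *
                   (\<Prod>k. weierstrass_term zs d k z)))"

section \<open>Infinite superelliptic curves\<close>

definition standard_charts :: "complex set \<Rightarrow> complex chart set" where
  "standard_charts Y = {(Y, \<lambda>z. z)}"

text \<open>
  The pullback of an atlas along a local homeomorphism \<open>p\<close> defined on \<open>X\<close>: the charts are
  \<open>\<phi> \<circ> p\<close> on the open sets that \<open>p\<close> maps homeomorphically onto an open part of the domain of \<open>\<phi>\<close>.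
\<close>

definition pullback_charts ::
  "'a::topological_space set \<Rightarrow> ('a \<Rightarrow> 'b::topological_space) \<Rightarrow> 'b chart set \<Rightarrow> 'a chart set" where
  "pullback_charts X p \<A> =
     {(U, \<phi> \<circ> p) | U V \<phi>. openin (top_of_set X) U \<and> (V, \<phi>) \<in> \<A> \<and>
        openin (top_of_set V) (p ` U) \<and> (\<exists>q. homeomorphism U (p ` U) p q)}"

definition superelliptic_curve :: "nat \<Rightarrow> (complex \<Rightarrow> complex) \<Rightarrow> (complex \<times> complex) set" where
  "superelliptic_curve n f = {(z, w). w ^ n = f z}"

definition superelliptic_surface ::
  "nat \<Rightarrow> (nat \<Rightarrow> complex) \<Rightarrow> (complex \<Rightarrow> complex) \<Rightarrow> (complex \<times> complex) translation_surface" where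
  "superelliptic_surface n zs f =
     (let \<Sigma> = range (\<lambda>k. (zs k, 0)) in
      \<lparr>points = superelliptic_curve n f,
       cone_points = \<Sigma>,
       charts = pullback_charts (superelliptic_curve n f - \<Sigma>) fst
                  (standard_charts (- range zs))\<rparr>)"

end

theory Submission
  imports Defs
begin

unbundle no fps_syntax

text \<open>
  Let \<open>Z\<close> be a very sparse set of points, invariant under \<open>G\<close>, and take the curve \<open>w\<^sup>2 = f z\<close>
  where \<open>f\<close> has simple zeros, exactly at \<open>Z\<close>. An affine diffeomorphism with linear part \<open>A\<close> covers
  a map \<open>z \<mapsto> A z + t\<close> of the plane that maps \<open>Z\<close> into itself, and sparsity forces \<open>A \<in> G\<close>.
  Conversely \<open>A \<in> G\<close> lifts to the curve because \<open>f (A z) / f z\<close> has a continuous square root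
  off \<open>Z\<close>: both \<open>f (A z)\<close> and \<open>f z\<close> wind once around every zero.
\<close>

section \<open>The action of matrices on the plane\<close>


text \<open>Two obstacles shape the proof. Elements of \<open>G\<close> are only real linear, so f
  (A z) / f z is not holomorphic and its root has to come from topology. A positive determinant
  makes f (A z) wind in the same direction as f z, so the quotient has winding number 0 about every
  zero and its root is single-valued. Conversely, an affine map changes moduli by bounded factors up
  to a bounded shift, while the moduli of successive nodes have unbounded ratios; hence distant
  nodes cannot change orbit. Merging local linear parts into one matrix needs the double cover
  without its branch points to be connected. Simplicity of the zeros gives this: a global
  holomorphic root of f would make them double.\<close>

lemma act_eq:
  "A \<bullet>\<^sub>c v = Complex (A$1$1 * Re v + A$1$2 * Im v) (A$2$1 * Re v + A$2$2 * Im v)"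
  by (simp add: act_def matrix_vector_mult_def sum_2 Let_def)

lemma act_add: "A \<bullet>\<^sub>c (v + w) = A \<bullet>\<^sub>c v + A \<bullet>\<^sub>c w"
  by (simp add: act_eq complex_eq_iff algebra_simps)

lemma act_diff: "A \<bullet>\<^sub>c (v - w) = A \<bullet>\<^sub>c v - A \<bullet>\<^sub>c w"
  by (simp add: act_eq complex_eq_iff algebra_simps)

lemma act_zero [simp]: "A \<bullet>\<^sub>c 0 = 0"
  by (simp add: act_eq complex_eq_iff)

lemma act_mult: "(A ** B) \<bullet>\<^sub>c v = A \<bullet>\<^sub>c (B \<bullet>\<^sub>c v)"
  by (simp add: act_eq complex_eq_iff matrix_matrix_mult_def sum_2 algebra_simps)

lemma act_one [simp]: "mat 1 \<bullet>\<^sub>c v = v"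
  by (simp add: act_eq complex_eq_iff mat_def)

lemma act_eq_on_basis_imp_eq:
  assumes "A \<bullet>\<^sub>c v = B \<bullet>\<^sub>c v" "A \<bullet>\<^sub>c w = B \<bullet>\<^sub>c w" "Re v * Im w \<noteq> Im v * Re w"
  shows "A = B"
proof -
  define C where "C = A - B"
  have *: "c = 0 \<and> d = 0" if "c * Re v + d * Im v = 0" "c * Re w + d * Im w = 0" for c d
  proof -
    have "c * (Re v * Im w - Im v * Re w) = 0" "d * (Re v * Im w - Im v * Re w) = 0"
      using that by algebra+
    thus ?thesis using assms(3) by simp
  qed
  have "C$1$1 * Re v + C$1$2 * Im v = 0" "C$1$1 * Re w + C$1$2 * Im w = 0"
       "C$2$1 * Re v + C$2$2 * Im v = 0" "C$2$1 * Re w + C$2$2 * Im w = 0"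
    using assms(1,2) by (auto simp: C_def act_eq algebra_simps)
  from *[OF this(1,2)] *[OF this(3,4)] have "C = 0"
    by (simp add: vec_eq_iff forall_2)
  thus ?thesis by (simp add: C_def)
qed

text \<open>Subtracting the values at \<open>z\<close> removes the translations, and a small real
  and a small imaginary vector form a basis. This makes linear parts unique.\<close>

lemma act_eq_on_open_imp_eq:
  assumes "open U" "z \<in> U" "\<And>y. y \<in> U \<Longrightarrow> A \<bullet>\<^sub>c y + s = B \<bullet>\<^sub>c y + t"
  shows "A = B"
proof -
  from assms(1,2) obtain e where e: "e > 0" "ball z e \<subseteq> U"
    by (auto simp: open_contains_ball)
  have *: "A \<bullet>\<^sub>c v = B \<bullet>\<^sub>c v" if "norm v < e" for v
  proof -
    have "z + v \<in> U" using e that by (auto simp: subset_iff dist_norm)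
    from assms(3)[OF this] assms(3)[OF assms(2)] show ?thesis
      by (simp add: act_add) (metis add.assoc add.commute add_left_cancel)
  qed
  show ?thesis
    by (rule act_eq_on_basis_imp_eq[of _ "of_real (e/2)" _ "\<i> * of_real (e/2)"])
       (use e in \<open>auto intro!: * simp: norm_mult\<close>)
qed

text \<open>This is the splitting into complex linear and antilinear parts; |a|^2 - |b|^2 is the
  Jacobian in Wirtinger form, so a positive determinant means that the linear part
  dominates.\<close>

lemma act_complex_form:
  assumes "0 < det A"
  obtains a b where "\<And>v. A \<bullet>\<^sub>c v = a * v + b * cnj v" "norm b < norm a"
proof -
  define a b where "a = Complex ((A$1$1 + A$2$2) / 2) ((A$2$1 - A$1$2) / 2)"
    and "b = Complex ((A$1$1 - A$2$2) / 2) ((A$2$1 + A$1$2) / 2)"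
  have "A \<bullet>\<^sub>c v = a * v + b * cnj v" for v
    by (simp add: act_eq a_def b_def complex_eq_iff field_simps)
  moreover have "(norm a)\<^sup>2 - (norm b)\<^sup>2 = det A"
    by (simp add: a_def b_def cmod_power2 det_2) (simp add: power2_eq_square field_simps)
  hence "norm b < norm a"
    using assms by (intro power2_less_imp_less[OF _ norm_ge_zero]) linarith
  ultimately show ?thesis using that by blast
qed

lemma act_upper_bound: obtains C where "C > 0" "\<And>v. norm (A \<bullet>\<^sub>c v) \<le> C * norm v"
proof
  \<comment> \<open>The summand 1 keeps the constant positive for the zero matrix.\<close>
  let ?C = "\<bar>A$1$1\<bar> + \<bar>A$1$2\<bar> + \<bar>A$2$1\<bar> + \<bar>A$2$2\<bar> + 1"
  show "?C > 0" by simp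
  fix v
  have "norm (A \<bullet>\<^sub>c v) \<le> \<bar>A$1$1 * Re v + A$1$2 * Im v\<bar> + \<bar>A$2$1 * Re v + A$2$2 * Im v\<bar>"
    using cmod_le[of "A \<bullet>\<^sub>c v"] by (simp add: act_eq)
  also have "\<dots> \<le> (\<bar>A$1$1\<bar> * \<bar>Re v\<bar> + \<bar>A$1$2\<bar> * \<bar>Im v\<bar>) + (\<bar>A$2$1\<bar> * \<bar>Re v\<bar> + \<bar>A$2$2\<bar> * \<bar>Im v\<bar>)"
    by (simp flip: abs_mult)
  also have "\<dots> \<le> (\<bar>A$1$1\<bar> * norm v + \<bar>A$1$2\<bar> * norm v) + (\<bar>A$2$1\<bar> * norm v + \<bar>A$2$2\<bar> * norm v)"
    by (intro add_mono mult_left_mono abs_Re_le_cmod abs_Im_le_cmod) auto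
  also have "\<dots> \<le> ?C * norm v" by (simp add: algebra_simps)
  finally show "norm (A \<bullet>\<^sub>c v) \<le> ?C * norm v" .
qed

text \<open>The constant |a| - |b| is the smaller singular value of \<open>A\<close>.\<close>

lemma act_lower_bound:
  assumes "0 < det A"
  obtains c where "c > 0" "\<And>v. c * norm v \<le> norm (A \<bullet>\<^sub>c v)"
proof -
  obtain a b where ab: "\<And>v. A \<bullet>\<^sub>c v = a * v + b * cnj v" "norm b < norm a"
    by (rule act_complex_form[OF assms]) blast
  show ?thesis
  proof (rule that[of "norm a - norm b"])
    fix v
    have "norm (a * v) - norm (b * cnj v) \<le> norm (A \<bullet>\<^sub>c v)"
      unfolding ab by (metis norm_diff_ineq)
    thus "(norm a - norm b) * norm v \<le> norm (A \<bullet>\<^sub>c v)"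
      by (simp add: norm_mult algebra_simps)
  qed (use ab in simp)
qed

lemma act_eq_0_iff:
  assumes "0 < det A" shows "A \<bullet>\<^sub>c v = 0 \<longleftrightarrow> v = 0"
proof -
  obtain c where c: "c > 0" "\<And>v. c * norm v \<le> norm (A \<bullet>\<^sub>c v)"
    by (rule act_lower_bound[OF assms]) blast
  show ?thesis using c(1) c(2)[of v] by (auto simp: mult_le_0_iff)
qed

lemma continuous_on_act [continuous_intros]:
  "continuous_on S g \<Longrightarrow> continuous_on S (\<lambda>x. A \<bullet>\<^sub>c g x)"
  unfolding act_eq by (intro continuous_intros)

lemma GL_plus_subgroupD:
  assumes "subgroup G GL_plus"
  shows "A \<in> G \<Longrightarrow> 0 < det A" "mat 1 \<in> G" "A \<in> G \<Longrightarrow> B \<in> G \<Longrightarrow> A ** B \<in> G"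
  using subgroup.subset[OF assms] subgroup.one_closed[OF assms] subgroup.m_closed[OF assms]
  by (auto simp: GL_plus_def)

lemma GL_plus_subgroup_inverse:
  assumes "subgroup G GL_plus" "A \<in> G"
  obtains B where "B \<in> G" "A ** B = mat 1" "B ** A = mat 1"
proof -
  have A: "0 < det A" using GL_plus_subgroupD assms by blast
  hence "invertible A" by (simp add: invertible_det_nz)
  then obtain B where inv: "A ** B = mat 1" "B ** A = mat 1"
    unfolding invertible_def by blast
  have "det A * det B = 1"
    using arg_cong[OF inv(1), of det] by (simp add: det_mul)
  with A have pos: "0 < det B"
    by (metis zero_less_mult_pos zero_less_one)
  \<comment> \<open>Closure of a \<open>subgroup\<close> under inverses speaks of
    \<open>m_inv\<close>, a definite description, which must be identified with the matrix
    inverse.\<close>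
  have "inv\<^bsub>GL_plus\<^esub> A = B"
    unfolding m_inv_def
  proof (rule the_equality)
    fix B' assume "B' \<in> carrier GL_plus \<and> A \<otimes>\<^bsub>GL_plus\<^esub> B' = \<one>\<^bsub>GL_plus\<^esub> \<and> B' \<otimes>\<^bsub>GL_plus\<^esub> A = \<one>\<^bsub>GL_plus\<^esub>"
    hence "B' ** A = mat 1" by (simp add: GL_plus_def)
    thus "B' = B"
      using inv(1) by (metis matrix_mul_assoc matrix_mul_lid matrix_mul_rid)
  qed (use inv pos in \<open>auto simp: GL_plus_def\<close>)
  with that inv subgroup.m_inv_closed[OF assms] show ?thesis by simp
qed

section \<open>A sparse invariant set of zeros\<close>

text \<open>Factorials make the ratios of successive moduli unbounded. The shift by
  \<open>Suc\<close> avoids 0! = 1!, which would repeat a node.\<close>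

definition node :: "nat \<Rightarrow> complex" where
  "node k = Complex (fact (Suc k)) ((fact (Suc k))\<^sup>2)"

lemma norm_node_ge: "real k + 1 \<le> norm (node k)"
proof -
  have "real (Suc k) \<le> real (fact (Suc k))" by (rule of_nat_mono, rule fact_ge_self)
  also have "\<dots> \<le> norm (node k)"
    using complex_Re_le_cmod[of "node k"] by (simp add: node_def del: fact_Suc)
  finally show ?thesis by simp
qed

lemma norm_node_Suc: "(real k + 2) * norm (node k) \<le> norm (node (Suc k))"
proof (rule power2_le_imp_le)
  define a c :: real where "a = fact (Suc k)" and "c = real k + 2"
  have c: "1 \<le> c" by (simp add: c_def)
  have s: "node k = Complex a (a\<^sup>2)" "node (Suc k) = Complex (c * a) ((c * a)\<^sup>2)"
    by (simp_all add: node_def a_def c_def field_simps)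
  \<comment> \<open>The abscissa grows by the factor c and the ordinate by c^2, so only the
    ordinates remain to be compared.\<close>
  have "c\<^sup>2 * (a^4) \<le> c^4 * (a^4)"
    using c by (intro mult_right_mono power_increasing) auto
  thus "((real k + 2) * norm (node k))\<^sup>2 \<le> (norm (node (Suc k)))\<^sup>2"
    unfolding s power_mult_distrib cmod_power2
    by (simp flip: c_def power_mult add: power_mult_distrib algebra_simps)
qed simp

text \<open>The factor is tied to the larger index, so it beats any constant as soon as one of the
  two indices is large.\<close>

lemma norm_node_gap:
  assumes "j < k" shows "(real k + 1) * norm (node j) \<le> norm (node k)"
proof -
  obtain d where k: "k = Suc (j + d)" using assms less_imp_Suc_add by blast
  have "norm (node j) \<le> norm (node (j + d))"
  proof (induction d)
    case (Suc d)
    have "1 * norm (node (j + d)) \<le> (real (j + d) + 2) * norm (node (j + d))"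
      by (intro mult_right_mono) auto
    with norm_node_Suc[of "j + d"] Suc show ?case by simp
  qed simp
  hence "(real k + 1) * norm (node j) \<le> (real (j + d) + 2) * norm (node (j + d))"
    unfolding k by (intro mult_mono) auto
  also have "\<dots> \<le> norm (node k)" unfolding k by (rule norm_node_Suc)
  finally show ?thesis .
qed

text \<open>The nodes lie on a parabola.\<close>

lemma node_not_collinear:
  assumes "p \<noteq> q" "p \<noteq> r" "q \<noteq> r"
  shows "Re (node q - node p) * Im (node r - node p) \<noteq> Im (node q - node p) * Re (node r - node p)"
proof -
  have inj: "(fact (Suc i) :: real) \<noteq> fact (Suc j)" if "i \<noteq> j" for i j
    using that fact_less_mono[of "Suc i" "Suc j", where 'a=real] fact_less_mono[of "Suc j" "Suc i", where 'a=real]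
    by (cases "i < j") (auto simp del: fact_Suc)
  define a b c :: real where "a = fact (Suc p)" and "b = fact (Suc q)" and "c = fact (Suc r)"
  have "(b - a) * (c - a) * (c - b) \<noteq> 0"
    using inj assms by (auto simp: a_def b_def c_def simp del: fact_Suc)
  \<comment> \<open>This is the Vandermonde determinant of the three abscissae.\<close>
  also have "(b - a) * (c - a) * (c - b) = (b - a) * (c\<^sup>2 - a\<^sup>2) - (b\<^sup>2 - a\<^sup>2) * (c - a)"
    by algebra
  finally show ?thesis
    by (simp add: node_def a_def b_def c_def del: fact_Suc)
qed

section \<open>Orbits of the nodes under a finite group\<close>

definition zero_set :: "(real^2^2) set \<Rightarrow> complex set" where
  "zero_set G = {A \<bullet>\<^sub>c node k | A k. A \<in> G}"

text \<open>Finiteness gives distortion constants common to all of \<open>G\<close>, through which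
  the orbits inherit the sparsity of the nodes.\<close>

lemma finite_act_bounds:
  assumes "finite G" "\<forall>A\<in>G. 0 < det A"
  obtains c C where "0 < c" "0 < C"
    "\<And>A v. A \<in> G \<Longrightarrow> c * norm v \<le> norm (A \<bullet>\<^sub>c v)" "\<And>A v. A \<in> G \<Longrightarrow> norm (A \<bullet>\<^sub>c v) \<le> C * norm v"
proof -
  have "\<exists>c C. 0 < c \<and> 0 < C \<and> (\<forall>A\<in>G. \<forall>v. c * norm v \<le> norm (A \<bullet>\<^sub>c v) \<and> norm (A \<bullet>\<^sub>c v) \<le> C * norm v)"
    using assms
  proof (induction G)
    case empty
    show ?case by (intro exI[of _ 1]) auto
  next
    case (insert B G)
    then obtain c C where c: "0 < c" "0 < C"
      "\<And>A v. A \<in> G \<Longrightarrow> c * norm v \<le> norm (A \<bullet>\<^sub>c v)" "\<And>A v. A \<in> G \<Longrightarrow> norm (A \<bullet>\<^sub>c v) \<le> C * norm v"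
      by auto
    obtain d where d: "0 < d" "\<And>v. d * norm v \<le> norm (B \<bullet>\<^sub>c v)"
      using act_lower_bound[of B] insert.prems by blast
    obtain D where D: "0 < D" "\<And>v. norm (B \<bullet>\<^sub>c v) \<le> D * norm v"
      by (rule act_upper_bound[of B]) blast
    have "min c d * norm v \<le> norm (A \<bullet>\<^sub>c v) \<and> norm (A \<bullet>\<^sub>c v) \<le> max C D * norm v"
      if "A \<in> insert B G" for A v
    proof -
      have "min c d * norm v \<le> c * norm v" "min c d * norm v \<le> d * norm v"
           "C * norm v \<le> max C D * norm v" "D * norm v \<le> max C D * norm v"
        by (auto intro!: mult_right_mono)
      with c(3,4)[of A v] d(2)[of v] D(2)[of v] that show ?thesis by fastforce
    qed
    with c(1,2) d(1) show ?case by (intro exI[of _ "min c d"] exI[of _ "max C D"]) auto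
  qed
  thus ?thesis using that by blast
qed

lemma finite_zero_set_cball:
  assumes "finite G" "\<forall>A\<in>G. 0 < det A"
  shows "finite (zero_set G \<inter> cball 0 r)"
proof -
  obtain c where c: "0 < c" "\<And>A v. A \<in> G \<Longrightarrow> c * norm v \<le> norm (A \<bullet>\<^sub>c v)"
    using finite_act_bounds[OF assms] by metis
  have "k \<le> nat \<lceil>r / c\<rceil>" if "A \<in> G" "norm (A \<bullet>\<^sub>c node k) \<le> r" for A k
  proof -
    have "c * (real k + 1) \<le> c * norm (node k)" using norm_node_ge c(1) by simp
    also have "\<dots> \<le> r" using c(2)[OF that(1), of "node k"] that(2) by linarith
    finally have "real k + 1 \<le> r / c" using c(1) by (simp add: field_simps)
    thus ?thesis by linarith
  qed
  hence "zero_set G \<inter> cball 0 r \<subseteq> (\<lambda>(A, k). A \<bullet>\<^sub>c node k) ` (G \<times> {..nat \<lceil>r / c\<rceil>})"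
    by (fastforce simp: zero_set_def)
  thus ?thesis using assms(1) finite_subset by blast
qed

lemma infinite_zero_set:
  assumes "subgroup G GL_plus"
  shows "infinite (zero_set G)"
proof -
  have "\<not> bounded (zero_set G)"
  proof
    assume "bounded (zero_set G)"
    then obtain r where r: "\<And>z. z \<in> zero_set G \<Longrightarrow> norm z \<le> r" by (auto simp: bounded_iff)
    have "node (nat \<lceil>r\<rceil>) \<in> zero_set G"
      using GL_plus_subgroupD(2)[OF assms] unfolding zero_set_def by (metis (mono_tags, lifting) act_one mem_Collect_eq)
    from r[OF this] norm_node_ge[of "nat \<lceil>r\<rceil>"] show False by linarith
  qed
  thus ?thesis using finite_imp_bounded by blast
qed

text \<open>This keeps the power of z out of the Weierstrass map.\<close>

lemma zero_notin_zero_set: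
  assumes "\<forall>A\<in>G. 0 < det A" shows "0 \<notin> zero_set G"
proof -
  have "node k \<noteq> 0" for k using norm_node_ge[of k] by auto
  with assms act_eq_0_iff show ?thesis by (force simp: zero_set_def)
qed

lemma act_zero_set:
  assumes "subgroup G GL_plus" "A \<in> G"
  shows "A \<bullet>\<^sub>c z \<in> zero_set G \<longleftrightarrow> z \<in> zero_set G"
proof -
  have *: "B \<bullet>\<^sub>c w \<in> zero_set G" if "B \<in> G" "w \<in> zero_set G" for B w
    using that GL_plus_subgroupD(3)[OF assms(1)] unfolding zero_set_def
    by (smt (verit, best) act_mult mem_Collect_eq)
  obtain B where "B \<in> G" "B ** A = mat 1" by (rule GL_plus_subgroup_inverse[OF assms])
  with *[of B "A \<bullet>\<^sub>c z"] *[of A z] assms(2) show ?thesis by (auto simp flip: act_mult)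
qed

text \<open>
  The nodes are so sparse that the map must send all but finitely many of them to the \<open>G\<close>-orbit
  they lie in. By the pigeonhole principle it then agrees with one element of \<open>G\<close> on three nodes.
\<close>

lemma zero_set_rigid:
  assumes "subgroup G GL_plus" "finite G" "0 < det A"
    and inv: "\<And>z. z \<in> zero_set G \<Longrightarrow> A \<bullet>\<^sub>c z + t \<in> zero_set G"
  shows "A \<in> G"
proof -
  have pos: "\<forall>A\<in>G. 0 < det A" using GL_plus_subgroupD(1)[OF assms(1)] by blast
  obtain c C where c: "0 < c" "0 < C"
    "\<And>B v. B \<in> G \<Longrightarrow> c * norm v \<le> norm (B \<bullet>\<^sub>c v)" "\<And>B v. B \<in> G \<Longrightarrow> norm (B \<bullet>\<^sub>c v) \<le> C * norm v"
    using finite_act_bounds[OF assms(2) pos] by metis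
  obtain d where d: "0 < d" "\<And>v. d * norm v \<le> norm (A \<bullet>\<^sub>c v)"
    using act_lower_bound[OF assms(3)] by blast
  obtain D where D: "0 < D" "\<And>v. norm (A \<bullet>\<^sub>c v) \<le> D * norm v"
    by (rule act_upper_bound[of A]) blast
  \<comment> \<open>The first two bounds make \<open>t\<close> negligible in the lower and the upper
    estimate of the image of a node; the last two exclude an image in the orbit of a later and of an
    earlier node.\<close>
  obtain K where K: "real K > max (max (2 * norm t / d) (norm t)) (max ((D + 1) / c) (2 * C / d))"
    using reals_Archimedean2 by blast
  have "\<exists>B\<in>G. A \<bullet>\<^sub>c node k + t = B \<bullet>\<^sub>c node k" if "k \<ge> K" for k
  proof -
    let ?N = "norm (node k)"
    have N: "?N \<ge> real k + 1" by (rule norm_node_ge)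
    have k: "2 * norm t / d < real k" "norm t < real k" "(D + 1) / c < real k" "2 * C / d < real k"
      using K that by auto
    have "node k \<in> zero_set G"
      using GL_plus_subgroupD(2)[OF assms(1)] unfolding zero_set_def
      by (metis (mono_tags, lifting) act_one mem_Collect_eq)
    from inv[OF this] obtain B j where B: "B \<in> G" "A \<bullet>\<^sub>c node k + t = B \<bullet>\<^sub>c node j"
      by (auto simp: zero_set_def)
    have "norm (A \<bullet>\<^sub>c node k + t) \<le> D * ?N + norm t"
      using norm_triangle_ineq[of "A \<bullet>\<^sub>c node k" t] D(2)[of "node k"] by linarith
    also have "\<dots> \<le> (D + 1) * ?N" using k(2) N by (simp add: algebra_simps)
    finally have up: "c * norm (node j) \<le> (D + 1) * ?N"
      using c(3)[OF B(1), of "node j"] B(2) by simp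
    have "2 * norm t < d * ?N"
    proof -
      have "2 * norm t / d < ?N" using k(1) N by linarith
      thus ?thesis using d(1) by (simp add: field_simps)
    qed
    hence "d / 2 * ?N \<le> d * ?N - norm t" by (simp add: field_simps)
    also have "\<dots> \<le> norm (A \<bullet>\<^sub>c node k + t)"
      using norm_diff_ineq[of "A \<bullet>\<^sub>c node k" t] d(2)[of "node k"] by linarith
    also have "\<dots> \<le> C * norm (node j)" using c(4)[OF B(1)] B(2) by simp
    finally have low: "d / 2 * ?N \<le> C * norm (node j)" .
    \<comment> \<open>The gap factor j + 1 exceeds (D + 1) / c, which contradicts \<open>up\<close>;
      the case j < k contradicts \<open>low\<close> in the same way.\<close>
    have "\<not> k < j"
    proof
      assume "k < j"
      have "c * ((real j + 1) * ?N) \<le> c * norm (node j)"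
        using norm_node_gap[OF \<open>k < j\<close>] c(1) by simp
      also note up
      finally have "(c * (real j + 1)) * ?N \<le> (D + 1) * ?N" by (simp only: mult.assoc)
      moreover have "0 < ?N" using N by linarith
      ultimately have "c * (real j + 1) \<le> D + 1" by (rule mult_right_le_imp_le)
      moreover have "D + 1 < c * real k" using k(3) c(1) by (simp add: field_simps)
      moreover have "c * real k \<le> c * (real j + 1)" using \<open>k < j\<close> c(1) by simp
      ultimately show False by linarith
    qed
    moreover have "\<not> j < k"
    proof
      assume "j < k"
      have "d / 2 * ((real k + 1) * norm (node j)) \<le> d / 2 * ?N"
        using norm_node_gap[OF \<open>j < k\<close>] d(1) by simp
      also note low
      finally have "d / 2 * (real k + 1) * norm (node j) \<le> C * norm (node j)" by (simp add: mult.assoc)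
      moreover have "norm (node j) > 0" using norm_node_ge[of j] by linarith
      ultimately have "d / 2 * (real k + 1) \<le> C" by simp
      moreover have "C < d / 2 * real k" using k(4) d(1) by (simp add: field_simps)
      moreover have "d / 2 * real k \<le> d / 2 * (real k + 1)" using d(1) by simp
      ultimately show False by linarith
    qed
    ultimately show ?thesis using B by (metis linorder_neqE_nat)
  qed
  then obtain h where h: "\<And>k. k \<ge> K \<Longrightarrow> h k \<in> G" "\<And>k. k \<ge> K \<Longrightarrow> A \<bullet>\<^sub>c node k + t = h k \<bullet>\<^sub>c node k"
    by metis
  have "\<exists>k0\<in>{K..}. infinite {k\<in>{K..}. h k = h k0}"
    using h(1) assms(2) by (intro pigeonhole_infinite) (auto intro: finite_subset[of _ G] simp: infinite_Ici)
  then obtain B where B: "B \<in> G" "infinite {k\<in>{K..}. h k = B}" (is "infinite ?I")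
    using h(1) by auto
  obtain P where P: "P \<subseteq> ?I" "card P = 3" using infinite_arbitrarily_large[OF B(2)] by blast
  obtain p q r where pqr: "P = {p, q, r}" "p \<noteq> q" "p \<noteq> r" "q \<noteq> r"
    using P(2) by (auto simp: card_3_iff)
  hence eq: "A \<bullet>\<^sub>c node p + t = B \<bullet>\<^sub>c node p" "A \<bullet>\<^sub>c node q + t = B \<bullet>\<^sub>c node q" "A \<bullet>\<^sub>c node r + t = B \<bullet>\<^sub>c node r"
    using h(2) P(1) by auto
  \<comment> \<open>Differences remove \<open>t\<close>, so three nodes are needed to obtain two
    independent vectors.\<close>
  have "A \<bullet>\<^sub>c (node q - node p) = B \<bullet>\<^sub>c (node q - node p)" "A \<bullet>\<^sub>c (node r - node p) = B \<bullet>\<^sub>c (node r - node p)"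
    unfolding act_diff eq[symmetric] by simp_all
  hence "A = B" by (rule act_eq_on_basis_imp_eq) (rule node_not_collinear[OF pqr(2-4)])
  with B(1) show ?thesis by simp
qed

section \<open>Enumeration of the zeros and the Weierstrass product\<close>

lemma discrete_enumeration:
  fixes Z :: "complex set"
  assumes "infinite Z" "\<And>r. finite (Z \<inter> cball 0 r)"
  obtains zs :: "nat \<Rightarrow> complex" where "inj zs" "range zs = Z" "filterlim (\<lambda>k. norm (zs k)) at_top sequentially"
proof -
  have "Z = (\<Union>n. Z \<inter> cball 0 (real n))"
    using real_arch_simple by auto
  moreover have "countable (\<Union>n. Z \<inter> cball 0 (real n))"
    using assms(2) by (intro countable_UN) (auto intro: countable_finite)
  ultimately have "bij_betw (from_nat_into Z) UNIV Z"
    using assms(1) bij_betw_from_nat_into by simp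
  then obtain zs :: "nat \<Rightarrow> complex" where zs: "inj zs" "range zs = Z"
    by (auto simp: bij_betw_def)
  moreover have "filterlim (\<lambda>k. norm (zs k)) at_top sequentially"
    unfolding filterlim_at_top
  proof
    fix r :: real
    have "finite (zs -` (Z \<inter> cball 0 r))" by (intro finite_vimageI assms zs)
    moreover have "{k. \<not> r \<le> norm (zs k)} \<subseteq> zs -` (Z \<inter> cball 0 r)" using zs(2) by auto
    ultimately have "finite {k. \<not> r \<le> norm (zs k)}" by (rule rev_finite_subset)
    thus "\<forall>\<^sub>F k in sequentially. r \<le> norm (zs k)"
      by (simp add: eventually_cofinite flip: cofinite_eq_sequentially)
  qed
  ultimately show ?thesis using that by blast
qed

lemma weierstrass_map_exists:
  assumes "inj zs" "filterlim (\<lambda>k. norm (zs k)) at_top sequentially" "0 \<notin> range zs"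
  obtains f where "weierstrass_map zs f" "f holomorphic_on UNIV" "\<And>z. f z = 0 \<longleftrightarrow> z \<in> range zs"
    "\<And>z. f z = 0 \<Longrightarrow> deriv f z \<noteq> 0"
proof -
  have nz: "zs k \<noteq> 0" for k using assms(3) by (metis rangeI)
  have inf: "filterlim zs at_infinity sequentially"
    using assms(2) by (simp add: filterlim_at_infinity_conv_norm_at_top)
  have sing: "finite (zs -` {z})" for z by (intro finite_vimageI assms) auto
  interpret W: weierstrass_product' zs
    by standard (use nz inf sing in auto)
  have factor: "weierstrass_term zs (\<lambda>k. k) k z = weierstrass_factor k (z / zs k)" for k z
    using nz by (simp add: weierstrass_term_def)
  have "uniformly_convergent_on K (\<lambda>N z. \<Prod>k<N. weierstrass_term zs (\<lambda>k. k) k z)" if cK: "compact K" for K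
  proof -
    obtain r where r: "r > 0" "K \<subseteq> cball 0 r"
      using bounded_subset_ballD[OF compact_imp_bounded[OF cK], of 0] ball_subset_cball by blast
    show ?thesis
      unfolding factor by (rule uniformly_convergent_on_subset[OF W.uniformly_convergent[OF r(1)] r(2)])
  qed
  hence "weierstrass_map zs W.f"
    unfolding weierstrass_map_def using assms
    \<comment> \<open>The choices are h = 1 and d(k) = k.\<close>
    by (intro conjI exI[of _ "\<lambda>_. 1"] exI[of _ "\<lambda>k. k"]) (auto simp: factor W.convergent W.f_def)
  moreover have "deriv W.f z \<noteq> 0" if fz: "W.f z = 0" for z
  proof
    assume d0: "deriv W.f z = 0"
    obtain k where k: "z = zs k" using fz W.zero[of z] by auto
    \<comment> \<open>The order of a zero is the number of indices that enumerate it, which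
      injectivity makes 1. Splitting off w - z then gives a non-zero derivative.\<close>
    have "zs -` {z} = {k}" using assms(1) by (auto simp: k inj_def)
    hence z1: "zorder W.f z = 1" using W.zorder[of z] by simp
    have "\<exists>w\<in>UNIV. W.f w \<noteq> 0" using W.zero[of 0] assms(3) by auto
    then obtain r where r: "r > 0" "zor_poly W.f z holomorphic_on cball z r"
      "\<forall>w\<in>cball z r. W.f w = zor_poly W.f z w * (w - z) ^ nat (zorder W.f z) \<and> zor_poly W.f z w \<noteq> 0"
      using zorder_exist_zero[OF W.holomorphic open_UNIV connected_UNIV UNIV_I, of z] by blast
    define g where "g = zor_poly W.f z"
    have g: "r > 0" "g holomorphic_on cball z r" "\<And>w. w \<in> cball z r \<Longrightarrow> W.f w = g w * (w - z)" "g z \<noteq> 0"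
      using r by (simp_all add: g_def z1)
    have "g field_differentiable at z"
      using g(1,2) by (meson ball_subset_cball centre_in_ball holomorphic_on_imp_differentiable_at holomorphic_on_subset open_ball)
    then obtain g' where "(g has_field_derivative g') (at z)" by (auto simp: field_differentiable_def)
    hence "((\<lambda>w. g w * (w - z)) has_field_derivative g z) (at z)"
      by (auto intro!: derivative_eq_intros)
    hence "(W.f has_field_derivative g z) (at z)"
      by (rule has_field_derivative_transform_within[OF _ g(1)]) (use g(3) in \<open>auto simp: dist_commute\<close>)
    with d0 g(4) show False by (simp add: DERIV_imp_deriv)
  qed
  ultimately show ?thesis using that W.zero W.holomorphic by blast
qed

section \<open>The double cover branched at simple zeros\<close>

locale simple_zeros =
  fixes zs :: "nat \<Rightarrow> complex" and f :: "complex \<Rightarrow> complex"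
  assumes holo: "f holomorphic_on UNIV"
    and zero_iff: "f z = 0 \<longleftrightarrow> z \<in> range zs"
    and simple: "f z = 0 \<Longrightarrow> deriv f z \<noteq> 0"
begin

lemma continuous_on_f: "continuous_on S f"
  using holo holomorphic_on_imp_continuous_on holomorphic_on_subset by blast

lemma DERIV_f: "(f has_field_derivative deriv f z) (at z)"
  using holo holomorphic_derivI by blast

lemma nonzeros_eq: "- range zs = {z. f z \<noteq> 0}"
  by (auto simp: zero_iff)

lemma open_nonzeros: "open {z. f z \<noteq> 0}"
  by (intro open_Collect_neq continuous_on_f continuous_on_const)

lemma continuous_on_nonzerosD:
  assumes "continuous_on {z. f z \<noteq> 0} g" "f z \<noteq> 0" shows "isCont g z"
  using assms open_nonzeros by (simp add: continuous_on_eq_continuous_at)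

lemma connected_nonzeros: "connected {z. f z \<noteq> 0}"
proof -
  have "connected (UNIV - range zs)"
    by (rule connected_open_diff_countable) auto
  also have "UNIV - range zs = {z. f z \<noteq> 0}" by (auto simp: zero_iff)
  finally show ?thesis .
qed

section \<open>Local and global square roots of f\<close>

lemma eventually_nonzero: "\<forall>\<^sub>F z in at z0. f z \<noteq> 0"
proof -
  have "\<not> UNIV \<subseteq> range zs"
    using uncountable_UNIV_complex countable_subset by blast
  then obtain b where "f b \<noteq> 0" by (auto simp: zero_iff)
  thus ?thesis using non_zero_neighbour_alt[OF holo open_UNIV connected_UNIV UNIV_I UNIV_I] by auto
qed

lemma local_sqrt:
  assumes "f z0 \<noteq> 0"
  obtains e s where "e > 0" "s holomorphic_on ball z0 e"
    "\<And>z. z \<in> ball z0 e \<Longrightarrow> (s z)\<^sup>2 = f z" "\<And>z. z \<in> ball z0 e \<Longrightarrow> f z \<noteq> 0"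
proof -
  obtain e where e: "e > 0" "ball z0 e \<subseteq> {z. f z \<noteq> 0}"
    using openE[OF open_nonzeros] assms by (metis (mono_tags) mem_Collect_eq)
  have h: "f holomorphic_on ball z0 e" using holo holomorphic_on_subset by blast
  obtain s where "s holomorphic_on ball z0 e" "\<And>z. z \<in> ball z0 e \<Longrightarrow> f z = s z ^ 2"
  proof (rule contractible_imp_holomorphic_sqrt[OF h])
    show "contractible (ball z0 e)" by (intro convex_imp_contractible convex_ball)
  qed (use e(2) in auto)
  moreover have "f z \<noteq> 0" if "z \<in> ball z0 e" for z using e(2) that by blast
  ultimately show ?thesis using that[of e s] e(1) by metis
qed

text \<open>Extended by 0, a root is continuous at a zero of f, hence holomorphic there by removal
  of singularities. Its square then has derivative 0 at that point, against simplicity.\<close>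

lemma no_holomorphic_sqrt:
  assumes r: "r holomorphic_on {z. f z \<noteq> 0}" and sq: "\<And>z. f z \<noteq> 0 \<Longrightarrow> (r z)\<^sup>2 = f z"
  shows False
proof -
  define z0 R where "z0 = zs 0" and "R = (\<lambda>z. if f z = 0 then 0 else r z)"
  have z0: "f z0 = 0" using zero_iff by (auto simp: z0_def)
  have R2: "(R z)\<^sup>2 = f z" for z using sq by (simp add: R_def)
  \<comment> \<open>The modulus of a root does not depend on the branch, which yields continuity at
    the zero.\<close>
  hence norm_R: "norm (R z) = sqrt (norm (f z))" for z
    by (metis norm_ge_zero norm_power real_sqrt_unique)
  obtain e where e: "e > 0" "\<And>z. z \<in> ball z0 e \<Longrightarrow> z \<noteq> z0 \<Longrightarrow> f z \<noteq> 0"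
    using eventually_nonzero[of z0] unfolding eventually_at by (auto simp: dist_commute)
  have hol: "R holomorphic_on (ball z0 e - {z0})"
  proof (rule holomorphic_transform)
    show "r holomorphic_on ball z0 e - {z0}"
      using e(2) by (intro holomorphic_on_subset[OF r]) blast
  qed (use e(2) in \<open>auto simp: R_def\<close>)
  have "isCont R z0"
  proof -
    have "((\<lambda>z. sqrt (norm (f z))) \<longlongrightarrow> sqrt (norm (f z0))) (at z0)"
      using DERIV_f[of z0] by (intro tendsto_intros) (metis DERIV_isCont isCont_def)
    hence "((\<lambda>z. norm (R z)) \<longlongrightarrow> 0) (at z0)" by (simp add: norm_R z0)
    thus ?thesis using z0 by (simp add: isCont_def R_def tendsto_norm_zero_cancel)
  qed
  moreover have "isCont R z" if "z \<in> ball z0 e - {z0}" for z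
    using hol that
    by (metis Diff_iff continuous_on_eq_continuous_at finite.emptyI finite_insert finite_imp_closed
          holomorphic_on_imp_continuous_on open_Diff open_ball)
  ultimately have "continuous_on (ball z0 e) R"
    by (intro continuous_at_imp_continuous_on) (metis Diff_iff singletonD)
  hence "R holomorphic_on ball z0 e"
    using hol by (rule no_isolated_singularity) auto
  then obtain R' where "(R has_field_derivative R') (at z0)"
    using e(1) by (meson centre_in_ball holomorphic_derivI open_ball)
  hence "((\<lambda>z. (R z)\<^sup>2) has_field_derivative 2 * R z0 * R') (at z0)"
    by (auto intro!: derivative_eq_intros)
  moreover have "R z0 = 0" by (simp add: R_def z0)
  ultimately have "(f has_field_derivative 0) (at z0)" by (simp add: R2)
  with simple[OF z0] show False by (simp add: DERIV_imp_deriv)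
qed

section \<open>Connectedness of the double cover off its branch points\<close>

definition reg :: "(complex \<times> complex) set" where
  "reg = {(z, w). w\<^sup>2 = f z \<and> f z \<noteq> 0}"

text \<open>
  Over a small disc \<open>reg\<close> consists of the two graphs of a square root and its negative, each of
  which lies entirely inside or outside a clopen set. A proper non-empty clopen subset would thus
  be the graph of a global holomorphic square root.
\<close>

lemma connected_reg: "connected reg"
  unfolding connected_clopen
proof (intro allI impI, elim conjE)
  fix T assume op: "openin (top_of_set reg) T" and cl: "closedin (top_of_set reg) T"
  have T: "T \<subseteq> reg" using op openin_imp_subset by blast
  have dich: "(\<forall>z\<in>ball z0 e. (z, s z) \<in> T) \<or> (\<forall>z\<in>ball z0 e. (z, s z) \<notin> T)"
    if s: "continuous_on (ball z0 e) s" "\<And>z. z \<in> ball z0 e \<Longrightarrow> (s z)\<^sup>2 = f z"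
      "\<And>z. z \<in> ball z0 e \<Longrightarrow> f z \<noteq> 0" for z0 e s
  proof -
    let ?h = "\<lambda>z. (z, s z)"
    have h: "continuous_on (ball z0 e) ?h" "?h \<in> ball z0 e \<rightarrow> reg"
      using s by (auto intro!: continuous_intros simp: reg_def)
    have "openin (top_of_set (ball z0 e)) (ball z0 e \<inter> ?h -` T)"
      "closedin (top_of_set (ball z0 e)) (ball z0 e \<inter> ?h -` T)"
      using continuous_openin_preimage[OF h op] continuous_closedin_preimage_gen[OF h cl] by auto
    hence "ball z0 e \<inter> ?h -` T = {} \<or> ball z0 e \<inter> ?h -` T = ball z0 e"
      using connected_ball[of z0 e] unfolding connected_clopen by blast
    thus ?thesis by auto
  qed
  have sheets: "w = s \<or> w = - s" if "w\<^sup>2 = f z" "s\<^sup>2 = f z" for w s z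
    using that by (metis power2_eq_iff)
  \<comment> \<open>One fibre inside \<open>T\<close>, or one disjoint from \<open>T\<close>, would
    force the same on all fibres; \<open>U\<close> covers both cases.\<close>
  have all_const: "\<forall>w. w\<^sup>2 = f b \<longrightarrow> (b, w) \<in> U"
    if all: "\<forall>w. w\<^sup>2 = f a \<longrightarrow> (a, w) \<in> U" and ab: "f a \<noteq> 0" "f b \<noteq> 0"
      and U: "U = T \<or> U = - T" for a b U
  proof (rule connected_induction_simple[OF connected_nonzeros, where P = "\<lambda>z. \<forall>w. w\<^sup>2 = f z \<longrightarrow> (z, w) \<in> U"])
    fix z0 assume "z0 \<in> {z. f z \<noteq> 0}"
    hence "f z0 \<noteq> 0" by simp
    then obtain e s where s: "e > 0" "s holomorphic_on ball z0 e"
      "\<And>z. z \<in> ball z0 e \<Longrightarrow> (s z)\<^sup>2 = f z" "\<And>z. z \<in> ball z0 e \<Longrightarrow> f z \<noteq> 0"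
      using local_sqrt by metis
    have "continuous_on (ball z0 e) s" using s(2) holomorphic_on_imp_continuous_on by blast
    hence *: "(x, s x) \<in> U \<longleftrightarrow> (y, s y) \<in> U" "(x, - s x) \<in> U \<longleftrightarrow> (y, - s y) \<in> U"
      if "x \<in> ball z0 e" "y \<in> ball z0 e" for x y
      using dich[of z0 e s] dich[of z0 e "\<lambda>z. - s z"] s(3,4) that U
      by (auto simp: continuous_on_minus)
    have op_ball: "openin (top_of_set {z. f z \<noteq> 0}) (ball z0 e)"
      using s(4) by (intro open_subset) auto
    have step: "\<forall>w. w\<^sup>2 = f y \<longrightarrow> (y, w) \<in> U"
      if xy: "x \<in> ball z0 e" "y \<in> ball z0 e" and x: "\<forall>w. w\<^sup>2 = f x \<longrightarrow> (x, w) \<in> U" for x y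
    proof -
      have "(x, s x) \<in> U" "(x, - s x) \<in> U" using x s(3) xy by auto
      thus ?thesis using *[OF xy] sheets[OF _ s(3)[OF xy(2)]] by auto
    qed
    show "\<exists>V. openin (top_of_set {z. f z \<noteq> 0}) V \<and> z0 \<in> V \<and>
        (\<forall>x\<in>V. \<forall>y\<in>V. (\<forall>w. w\<^sup>2 = f x \<longrightarrow> (x, w) \<in> U) \<longrightarrow> (\<forall>w. w\<^sup>2 = f y \<longrightarrow> (y, w) \<in> U))"
    proof (intro exI[of _ "ball z0 e"] conjI op_ball ballI impI)
      show "z0 \<in> ball z0 e" using s(1) by simp
    qed (rule step)
  qed (use all ab in auto)
  show "T = {} \<or> T = reg"
  proof (rule ccontr)
    assume "\<not> (T = {} \<or> T = reg)"
    then obtain a1 w1 a2 w2 where w: "(a1, w1) \<in> T" "(a2, w2) \<in> reg" "(a2, w2) \<notin> T"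
      using T by (metis subset_antisym subrelI surj_pair ex_in_conv)
    have w1: "f a1 \<noteq> 0" "w1\<^sup>2 = f a1" "f a2 \<noteq> 0" "w2\<^sup>2 = f a2"
      using w T by (auto simp: reg_def)
    have ex: "\<exists>w. w\<^sup>2 = f z \<and> (z, w) \<in> T" "\<exists>w. w\<^sup>2 = f z \<and> (z, w) \<notin> T" if "f z \<noteq> 0" for z
      using all_const[of z "- T" a1] all_const[of z T a2] w w1 that by auto
    have "\<exists>!w. (z, w) \<in> T" if z: "f z \<noteq> 0" for z
    proof -
      obtain w w' where ww: "w\<^sup>2 = f z" "(z, w) \<in> T" "w'\<^sup>2 = f z" "(z, w') \<notin> T"
        using ex[OF z] by blast
      have "w' = - w" using sheets[OF ww(3,1)] ww by auto
      with ww show ?thesis using sheets[OF _ ww(1)] T by (intro ex1I[of _ w]) (auto simp: reg_def)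
    qed
    then obtain r where r: "\<And>z w. f z \<noteq> 0 \<Longrightarrow> (z, w) \<in> T \<longleftrightarrow> w = r z"
      by (metis (full_types))
    have r2: "(r z)\<^sup>2 = f z" if "f z \<noteq> 0" for z
      using r[OF that, of "r z"] T by (auto simp: reg_def)
    have "r holomorphic_on {z. f z \<noteq> 0}"
    proof (rule holomorphic_onI)
      fix z0 assume "z0 \<in> {z. f z \<noteq> 0}"
      hence z0: "f z0 \<noteq> 0" by simp
      then obtain e s where s: "e > 0" "s holomorphic_on ball z0 e"
        "\<And>z. z \<in> ball z0 e \<Longrightarrow> (s z)\<^sup>2 = f z" "\<And>z. z \<in> ball z0 e \<Longrightarrow> f z \<noteq> 0"
        using local_sqrt by metis
      have "\<exists>s. s holomorphic_on ball z0 e \<and> (\<forall>z\<in>ball z0 e. (s z)\<^sup>2 = f z) \<and> s z0 = r z0"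
      proof -
        have "r z0 = s z0 \<or> r z0 = - s z0" using sheets[OF r2[OF z0] s(3)[of z0]] s(1) by simp
        thus ?thesis
        proof
          assume "r z0 = - s z0"
          thus ?thesis using s(3)
            by (intro exI[of _ "\<lambda>z. - s z"]) (auto intro!: holomorphic_intros s(2))
        qed (use s in auto)
      qed
      then obtain s' where s': "s' holomorphic_on ball z0 e" "\<And>z. z \<in> ball z0 e \<Longrightarrow> (s' z)\<^sup>2 = f z" "s' z0 = r z0"
        by blast
      \<comment> \<open>The local root through the point of \<open>T\<close> over z0 stays in
        \<open>T\<close>, so it coincides with \<open>r\<close> on the disc.\<close>
      have "(z0, s' z0) \<in> T" "z0 \<in> ball z0 e" using r[OF z0] s'(3) s(1) by simp_all
      hence "\<forall>z\<in>ball z0 e. (z, s' z) \<in> T"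
        using dich[OF holomorphic_on_imp_continuous_on[OF s'(1)] s'(2) s(4)] by blast
      hence eq: "\<And>z. z \<in> ball z0 e \<Longrightarrow> s' z = r z" using r s(4) by blast
      have "r holomorphic_on ball z0 e"
        using s'(1) by (rule holomorphic_transform) (rule eq)
      thus "r field_differentiable at z0 within {z. f z \<noteq> 0}"
        using s(1) by (meson centre_in_ball field_differentiable_at_within holomorphic_on_imp_differentiable_at open_ball)
    qed
    thus False using no_holomorphic_sqrt r2 by blast
  qed
qed

subsection \<open>The square root of the quotient \<open>f (A z) / f z\<close>\<close>

text \<open>
  Write \<open>A v = a v + b (cnj v)\<close> with \<open>\<bar>b\<bar> < \<bar>a\<bar>\<close>. At a zero \<open>z0\<close>, the quotient \<open>f (A z) / f z\<close>
  behaves like \<open>A v / v = a + b (cnj v / v)\<close> with \<open>v = z - z0\<close>. Below, \<open>\<mu>\<close> is a global continuous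
  substitute for \<open>cnj v / v\<close> of modulus at most 1 (near \<open>z0\<close>, \<open>v\<close> is approximately \<open>f z / f' z\<close>). So
  \<open>a + b \<mu>\<close> stays in a half plane and has a square root, and the quotient of
  \<open>f (A z) / f z\<close> by it extends to a zero-free continuous function on the plane.
\<close>

lemma act_lift_factor:
  assumes "0 < det A" and inv: "\<And>z. f (A \<bullet>\<^sub>c z) = 0 \<longleftrightarrow> f z = 0"
  obtains u where "continuous_on {z. f z \<noteq> 0} u" "\<And>z. f z \<noteq> 0 \<Longrightarrow> (u z)\<^sup>2 * f z = f (A \<bullet>\<^sub>c z)"
proof -
  obtain a b where ab: "\<And>v. A \<bullet>\<^sub>c v = a * v + b * cnj v" "norm b < norm a"
    by (rule act_complex_form[OF assms(1)]) blast
  have a0: "a \<noteq> 0" using ab(2) by auto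
  \<comment> \<open>With d = f' z0, cnj f / f behaves like (cnj d / d) (cnj v / v), and f'^2 / n
    tends to d / cnj d, cancelling the first factor. The summand |f|^2 keeps \<open>n\<close>
    positive at critical points of f; at zeros simplicity does.\<close>
  define n where "n = (\<lambda>z. (norm (deriv f z))\<^sup>2 + (norm (f z))\<^sup>2)"
  define \<mu> where "\<mu> = (\<lambda>z. cnj (f z) / f z * ((deriv f z)\<^sup>2 / of_real (n z)))"
  define L where "L = (\<lambda>z. a + b * \<mu> z)"
  define Q where "Q = (\<lambda>z. if f z = 0 then deriv f (A \<bullet>\<^sub>c z) / deriv f z else f (A \<bullet>\<^sub>c z) / (f z * L z))"
  have n0: "n z > 0" for z
    using simple[of z] by (cases "f z = 0") (auto simp: n_def intro: add_nonneg_pos)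
  have norm_\<mu>: "norm (\<mu> z) \<le> 1" for z
  proof -
    have "(norm (deriv f z))\<^sup>2 / n z \<le> 1" using n0[of z] by (simp add: n_def)
    thus ?thesis using n0[of z]
      by (cases "f z = 0") (auto simp: \<mu>_def norm_mult norm_divide norm_power)
  qed
  have norm_b\<mu>: "norm (b * \<mu> z) \<le> norm b" for z
    using mult_left_mono[OF norm_\<mu>[of z], of "norm b"] by (simp add: norm_mult)
  have norm_L: "norm a - norm b \<le> norm (L z)" for z
    using norm_diff_ineq[of a "b * \<mu> z"] norm_b\<mu>[of z] unfolding L_def by linarith
  hence L0: "L z \<noteq> 0" for z using ab(2) by (metis diff_gt_0_iff_gt leD norm_zero)
  have L_half_plane: "L z / a \<notin> \<real>\<^sub>\<le>\<^sub>0" for z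
  proof -
    have "norm (b * \<mu> z / a) < 1"
      using norm_b\<mu>[of z] ab(2) by (simp add: norm_divide divide_less_eq)
    hence "Re (1 + b * \<mu> z / a) > 0"
      using abs_Re_le_cmod[of "b * \<mu> z / a"] by simp
    also have "1 + b * \<mu> z / a = L z / a" using a0 by (simp add: L_def field_simps)
    finally show ?thesis by (auto simp: complex_nonpos_Reals_iff)
  qed
  have cont_deriv: "continuous_on S (deriv f)" for S
    using holomorphic_deriv[OF holo open_UNIV] holomorphic_on_imp_continuous_on continuous_on_subset by blast
  have cont_fA: "continuous_on S (\<lambda>z. f (A \<bullet>\<^sub>c z))" for S
    by (rule continuous_on_compose2[OF continuous_on_f[of UNIV]]) (auto intro: continuous_intros)
  have cont_L: "continuous_on {z. f z \<noteq> 0} L"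
    unfolding L_def \<mu>_def n_def
    using n0 by (intro continuous_intros continuous_on_f cont_deriv)
      (auto simp: n_def simp flip: of_real_add of_real_power dest: less_imp_neq)
  have "isCont Q z0" for z0
  proof (cases "f z0 = 0")
    case False
    have "continuous_on {z. f z \<noteq> 0} Q"
      unfolding Q_def using L0
      by (subst continuous_on_cong[OF refl, of _ _ "\<lambda>z. f (A \<bullet>\<^sub>c z) / (f z * L z)"])
         (auto intro!: continuous_intros cont_fA cont_L continuous_on_f)
    thus ?thesis using False by (rule continuous_on_nonzerosD)
  next
    case True
    define d where "d = deriv f z0"
    have d0: "d \<noteq> 0" using simple[OF True] by (simp add: d_def)
    define v where "v = (\<lambda>z. z - z0)"
    have ev: "\<forall>\<^sub>F z in at z0. f z \<noteq> 0 \<and> v z \<noteq> 0"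
      using eventually_nonzero[of z0] eventually_neq_at_within[of z0 z0 UNIV]
      by eventually_elim (auto simp: v_def)
    have cont_at: "(g \<longlongrightarrow> g z0) (at z0)" if "continuous_on UNIV g" for g :: "complex \<Rightarrow> complex"
      using that by (simp add: continuous_on_def)
    have lim_f: "((\<lambda>z. f z / v z) \<longlongrightarrow> d) (at z0)"
      using DERIV_f[of z0] True by (simp add: has_field_derivative_iff v_def d_def)
    have lim_fA: "((\<lambda>z. f (A \<bullet>\<^sub>c z) / (A \<bullet>\<^sub>c v z)) \<longlongrightarrow> deriv f (A \<bullet>\<^sub>c z0)) (at z0)"
    proof -
      have "filterlim (\<lambda>z. A \<bullet>\<^sub>c z) (at (A \<bullet>\<^sub>c z0)) (at z0)"
      proof (rule filterlim_atI)
        show "\<forall>\<^sub>F z in at z0. A \<bullet>\<^sub>c z \<noteq> A \<bullet>\<^sub>c z0"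
          using ev
          by eventually_elim (metis act_eq_0_iff[OF assms(1)] act_diff right_minus_eq v_def)
      qed (intro cont_at continuous_intros)
      moreover have "((\<lambda>y. (f y - f (A \<bullet>\<^sub>c z0)) / (y - A \<bullet>\<^sub>c z0)) \<longlongrightarrow> deriv f (A \<bullet>\<^sub>c z0)) (at (A \<bullet>\<^sub>c z0))"
        using DERIV_f by (simp add: has_field_derivative_iff)
      ultimately have "((\<lambda>z. (f (A \<bullet>\<^sub>c z) - f (A \<bullet>\<^sub>c z0)) / (A \<bullet>\<^sub>c z - A \<bullet>\<^sub>c z0)) \<longlongrightarrow> deriv f (A \<bullet>\<^sub>c z0)) (at z0)"
        by (rule filterlim_compose[rotated])
      moreover have "f (A \<bullet>\<^sub>c z0) = 0" using True inv by simp
      ultimately show ?thesis by (simp add: v_def act_diff)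
    qed
    have lim_\<mu>: "((\<lambda>z. \<mu> z * v z / cnj (v z)) \<longlongrightarrow> 1) (at z0)"
    proof -
      have "((\<lambda>z. cnj (f z / v z) / (f z / v z) * ((deriv f z)\<^sup>2 / of_real ((norm (deriv f z))\<^sup>2 + (norm (f z))\<^sup>2)))
              \<longlongrightarrow> cnj d / d * (d\<^sup>2 / of_real ((norm d)\<^sup>2 + (norm (f z0))\<^sup>2))) (at z0)"
        using d0 unfolding d_def
        by (intro tendsto_intros lim_f[unfolded d_def] cont_at cont_deriv continuous_on_f)
           (auto simp: True simp flip: of_real_power)
      also have "cnj d / d * (d\<^sup>2 / of_real ((norm d)\<^sup>2 + (norm (f z0))\<^sup>2)) = 1"
        using d0 complex_norm_square[of d] by (simp add: True power2_eq_square mult.commute)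
      finally show ?thesis
        by (rule Lim_transform_eventually) (use ev in eventually_elim, auto simp: \<mu>_def n_def field_simps)
    qed
    \<comment> \<open>In general A v / v has no limit at v = 0; only its quotient by L does. Their
      difference is b times a unimodular factor times an error tending to 0, and |L| is at least |a|
      - |b|.\<close>
    have lim_L: "((\<lambda>z. (A \<bullet>\<^sub>c v z / v z) / L z) \<longlongrightarrow> 1) (at z0)"
    proof -
      let ?e = "\<lambda>z. norm b * norm (1 - \<mu> z * v z / cnj (v z)) / (norm a - norm b)"
      have "\<forall>\<^sub>F z in at z0. norm ((A \<bullet>\<^sub>c v z / v z) / L z - 1) \<le> ?e z"
        using ev
      proof eventually_elim
        case (elim z)
        have "(A \<bullet>\<^sub>c v z / v z) / L z - 1 = b * (cnj (v z) / v z) * (1 - \<mu> z * v z / cnj (v z)) / L z"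
        proof -
          have "A \<bullet>\<^sub>c v z / v z - L z = b * (cnj (v z) / v z) * (1 - \<mu> z * v z / cnj (v z))"
            using elim by (simp add: ab(1) L_def field_simps)
          thus ?thesis using L0[of z] by (metis diff_divide_distrib divide_self)
        qed
        hence "norm ((A \<bullet>\<^sub>c v z / v z) / L z - 1) = norm b * norm (1 - \<mu> z * v z / cnj (v z)) / norm (L z)"
          using elim by (simp only: norm_mult norm_divide complex_mod_cnj) simp
        also have "\<dots> \<le> ?e z"
          using norm_L[of z] ab(2) by (intro divide_left_mono) (auto intro!: mult_pos_pos simp: L0)
        finally show ?case .
      qed
      moreover have "(?e \<longlongrightarrow> norm b * norm (1 - 1 :: complex) / (norm a - norm b)) (at z0)"
        using ab(2) by (intro tendsto_intros lim_\<mu>) auto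
      hence "(?e \<longlongrightarrow> 0) (at z0)" by simp
      ultimately have "((\<lambda>z. (A \<bullet>\<^sub>c v z / v z) / L z - 1) \<longlongrightarrow> 0) (at z0)"
        by (rule Lim_null_comparison)
      thus ?thesis by (simp add: LIM_zero_iff)
    qed
    \<comment> \<open>Off z0, Q is split into a difference quotient of f at A z0, one at z0, and the
      ratio just treated.\<close>
    have "((\<lambda>z. f (A \<bullet>\<^sub>c z) / (A \<bullet>\<^sub>c v z) / (f z / v z) * ((A \<bullet>\<^sub>c v z / v z) / L z))
            \<longlongrightarrow> deriv f (A \<bullet>\<^sub>c z0) / d * 1) (at z0)"
      using d0 by (intro tendsto_intros lim_f lim_fA lim_L)
    hence "(Q \<longlongrightarrow> deriv f (A \<bullet>\<^sub>c z0) / d * 1) (at z0)"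
    proof (rule Lim_transform_eventually)
      show "\<forall>\<^sub>F z in at z0. f (A \<bullet>\<^sub>c z) / (A \<bullet>\<^sub>c v z) / (f z / v z) * ((A \<bullet>\<^sub>c v z / v z) / L z) = Q z"
        using ev
        by eventually_elim (auto simp: Q_def act_eq_0_iff[OF assms(1)])
    qed
    thus ?thesis by (simp add: isCont_def Q_def True d_def)
  qed
  hence "continuous_on UNIV Q" by (simp add: continuous_on_eq_continuous_at)
  moreover have "Q z \<noteq> 0" for z using simple inv L0 by (auto simp: Q_def)
  ultimately obtain g where g: "continuous_on UNIV g" "\<And>z. Q z = exp (g z)"
    using continuous_logarithm_on_contractible[OF _ contractible_UNIV] by (metis UNIV_I)
  show ?thesis
  \<comment> \<open>This is a root of Q L. Dividing L by a moves it into the right half plane, where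
    \<open>csqrt\<close> is continuous; \<open>csqrt a\<close> undoes the division.\<close>
  proof (rule that[of "\<lambda>z. exp (g z / 2) * csqrt a * csqrt (L z / a)"])
    show "continuous_on {z. f z \<noteq> 0} (\<lambda>z. exp (g z / 2) * csqrt a * csqrt (L z / a))"
    proof (intro continuous_intros continuous_on_compose2[OF continuous_on_csqrt])
      show "continuous_on {z. f z \<noteq> 0} g" using g(1) continuous_on_subset by blast
    qed (use cont_L a0 L_half_plane in \<open>auto intro!: continuous_intros\<close>)
    fix z assume z: "f z \<noteq> 0"
    have "(exp (g z / 2))\<^sup>2 = Q z" by (simp add: g(2) flip: exp_double)
    hence "(exp (g z / 2) * csqrt a * csqrt (L z / a))\<^sup>2 = Q z * L z"
      using a0 by (simp add: power_mult_distrib)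
    thus "(exp (g z / 2) * csqrt a * csqrt (L z / a))\<^sup>2 * f z = f (A \<bullet>\<^sub>c z)"
      using z L0[of z] by (simp add: Q_def)
  qed
qed

subsection \<open>Affine diffeomorphisms of the double cover\<close>

definition curve :: "(complex \<times> complex) set" where
  "curve = {(z, w). w\<^sup>2 = f z}"

abbreviation surface :: "(complex \<times> complex) translation_surface" where
  "surface \<equiv> superelliptic_surface 2 zs f"

lemma points_surface: "points surface = curve"
  by (simp add: superelliptic_surface_def Let_def superelliptic_curve_def curve_def)

lemma cone_points_surface: "cone_points surface = {(z, w). w = 0 \<and> f z = 0}"
  by (auto simp: superelliptic_surface_def Let_def zero_iff)

lemma regular_points_surface: "regular_points surface = reg"
  unfolding regular_points_def points_surface cone_points_surface curve_def reg_def by auto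

lemma reg_eq: "reg = curve - cone_points surface"
  using regular_points_surface by (simp add: regular_points_def points_surface)

lemma reg_subset_curve: "reg \<subseteq> curve"
  by (auto simp: reg_def curve_def)

lemma charts_surface:
  "charts surface = {(U, (\<lambda>z. z) \<circ> fst) | U. openin (top_of_set reg) U \<and> open (fst ` U) \<and>
     (\<exists>q. homeomorphism U (fst ` U) fst q)}"
proof -
  have "superelliptic_curve 2 f - range (\<lambda>k. (zs k, 0)) = reg"
    using reg_eq by (simp add: superelliptic_surface_def Let_def superelliptic_curve_def curve_def)
  moreover have "openin (top_of_set (- range zs)) (fst ` U) \<longleftrightarrow> open (fst ` U)" if "openin (top_of_set reg) U" for U
  proof -
    have "fst ` U \<subseteq> - range zs"
      using openin_imp_subset[OF that] by (auto simp: reg_def zero_iff)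
    thus ?thesis using open_nonzeros by (simp add: nonzeros_eq openin_open_eq)
  qed
  ultimately show ?thesis
    unfolding superelliptic_surface_def Let_def pullback_charts_def standard_charts_def
    by fastforce
qed

lemma chart_exists:
  assumes "p \<in> reg"
  obtains U q where "p \<in> U" "openin (top_of_set reg) U" "open (fst ` U)" "homeomorphism U (fst ` U) fst q"
proof -
  obtain z0 w0 where p: "p = (z0, w0)" by fastforce
  have z0: "f z0 \<noteq> 0" "w0\<^sup>2 = f z0" using assms by (auto simp: p reg_def)
  obtain e s where s: "e > 0" "s holomorphic_on ball z0 e"
    "\<And>z. z \<in> ball z0 e \<Longrightarrow> (s z)\<^sup>2 = f z" "\<And>z. z \<in> ball z0 e \<Longrightarrow> f z \<noteq> 0"
    using local_sqrt[OF z0(1)] by metis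
  have "w0 = s z0 \<or> w0 = - s z0" using s(1,3) z0(2) by (metis centre_in_ball power2_eq_iff)
  then obtain c where c: "c * s z0 = w0" "c\<^sup>2 = 1"
    by (metis mult_1 mult_minus1 one_power2 power2_minus)
  define r where "r = (\<lambda>z. c * s z)"
  have r: "continuous_on (ball z0 e) r" "\<And>z. z \<in> ball z0 e \<Longrightarrow> (r z)\<^sup>2 = f z" "r z0 = w0"
    using c s(3) holomorphic_on_imp_continuous_on[OF s(2)]
    by (auto simp: r_def power_mult_distrib intro!: continuous_intros)
  define V where "V = reg \<inter> fst -` ball z0 e"
  \<comment> \<open>Each fibre is {r z, - r z}, so excluding w = - r z by an open condition leaves
    exactly the graph of \<open>r\<close>.\<close>
  define U where "U = V \<inter> (\<lambda>x. snd x + r (fst x)) -` (- {0})"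
  have V: "openin (top_of_set reg) V"
    unfolding V_def by (intro continuous_openin_preimage_gen continuous_on_fst continuous_on_id open_ball)
  have "openin (top_of_set V) U"
    unfolding U_def
  proof (intro continuous_openin_preimage_gen)
    show "continuous_on V (\<lambda>x. snd x + r (fst x))"
      by (intro continuous_intros continuous_on_compose2[OF r(1)]) (auto simp: V_def)
  qed auto
  hence U: "openin (top_of_set reg) U" using V openin_trans by blast
  have Ueq: "(z, w) \<in> U \<longleftrightarrow> z \<in> ball z0 e \<and> w = r z" for z w
  proof
    assume "(z, w) \<in> U"
    hence *: "z \<in> ball z0 e" "w\<^sup>2 = f z" "w + r z \<noteq> 0" by (auto simp: U_def V_def reg_def)
    hence "w\<^sup>2 = (r z)\<^sup>2" using r(2) by simp
    thus "z \<in> ball z0 e \<and> w = r z" using * by (auto simp: power2_eq_iff)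
  next
    assume "z \<in> ball z0 e \<and> w = r z"
    thus "(z, w) \<in> U" using r(2)[of z] s(4)[of z] by (auto simp: U_def V_def reg_def)
  qed
  have im: "fst ` U = ball z0 e" using Ueq by (force simp: image_iff)
  have hom: "homeomorphism U (fst ` U) fst (\<lambda>z. (z, r z))"
    unfolding im homeomorphism_def
    using Ueq r(1) im by (auto intro!: continuous_intros simp: image_iff split: prod.splits) 
  show ?thesis
    using that[of U] U hom im Ueq p r(3) s(1) by auto
qed

text \<open>Agreement of affine maps on the cover thereby becomes agreement on an open set of the
  plane.\<close>

lemma open_fst_image:
  assumes "openin (top_of_set reg) W"
  shows "open (fst ` W)"
proof (subst open_subopen, safe)
  fix z w assume zw: "(z, w) \<in> W"
  hence "(z, w) \<in> reg" using openin_imp_subset[OF assms] by blast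
  then obtain U q where U: "(z, w) \<in> U" "openin (top_of_set reg) U" "open (fst ` U)"
    "homeomorphism U (fst ` U) fst q"
    by (rule chart_exists)
  have "openin (top_of_set U) (W \<inter> U)"
    using openin_Int[OF assms U(2)] openin_imp_subset[OF U(2)] by (meson inf_le2 openin_subset_trans)
  hence "openin (top_of_set (fst ` U)) (fst ` (W \<inter> U))"
    using homeomorphism_imp_open_map[OF U(4)] by blast
  hence "open (fst ` (W \<inter> U))" using U(3) by (simp add: openin_open_eq)
  thus "\<exists>T. open T \<and> fst (z, w) \<in> T \<and> T \<subseteq> fst ` W"
    using zw U(1) by (intro exI[of _ "fst ` (W \<inter> U)"]) force
qed

definition affine_near :: "real^2^2 \<Rightarrow> complex \<Rightarrow> (complex \<times> complex \<Rightarrow> complex \<times> complex) \<Rightarrow> complex \<times> complex \<Rightarrow> bool" where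
  "affine_near A t T x \<longleftrightarrow> (\<exists>W. openin (top_of_set reg) W \<and> x \<in> W \<and> (\<forall>y\<in>W. fst (T y) = A \<bullet>\<^sub>c fst y + t))"

lemma affine_at_chartsD:
  assumes "affine_at S A T x" "(U, \<phi>) \<in> charts S" "(V, \<psi>) \<in> charts S" "x \<in> U" "T x \<in> V"
  obtains W t where "openin (top_of_set U) W" "x \<in> W" "\<And>y. y \<in> W \<Longrightarrow> \<psi> (T y) = A \<bullet>\<^sub>c \<phi> y + t"
proof -
  have "\<exists>W t. openin (top_of_set U) W \<and> x \<in> W \<and> T ` W \<subseteq> V \<and> (\<forall>y\<in>W. \<psi> (T y) = A \<bullet>\<^sub>c \<phi> y + t)"
    using bspec[OF bspec[OF assms(1)[unfolded affine_at_def] assms(2), unfolded case_prod_conv] assms(3)]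
      assms(4,5) by simp
  with that show ?thesis by blast
qed

text \<open>All charts are restrictions of \<open>fst\<close>, so one translation serves every pair
  of them. Forwards, charts around x and T x must exist, since \<open>affine_at\<close> quantifies
  over charts universally; backwards, the neighbourhood is shrunk until \<open>T\<close> maps it
  into the target chart.\<close>

lemma affine_at_iff:
  assumes T: "continuous_on reg T" "T \<in> reg \<rightarrow> reg" and x: "x \<in> reg"
  shows "affine_at surface A T x \<longleftrightarrow> (\<exists>t. affine_near A t T x)"
proof
  assume aff: "affine_at surface A T x"
  obtain U q where U: "x \<in> U" "openin (top_of_set reg) U" "open (fst ` U)" "homeomorphism U (fst ` U) fst q"
    using x by (rule chart_exists)
  have "T x \<in> reg" using T(2) x by blast
  then obtain V r where V: "T x \<in> V" "openin (top_of_set reg) V" "open (fst ` V)" "homeomorphism V (fst ` V) fst r"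
    by (rule chart_exists)
  have "(U, (\<lambda>z. z) \<circ> fst) \<in> charts surface" "(V, (\<lambda>z. z) \<circ> fst) \<in> charts surface"
    unfolding charts_surface using U V by blast+
  from affine_at_chartsD[OF aff this U(1) V(1)] obtain W t where W: "openin (top_of_set U) W" "x \<in> W"
    "\<And>y. y \<in> W \<Longrightarrow> fst (T y) = A \<bullet>\<^sub>c fst y + t"
    by (metis comp_apply)
  from W(1) U(2) have "openin (top_of_set reg) W" by (rule openin_trans)
  with W show "\<exists>t. affine_near A t T x" unfolding affine_near_def by blast
next
  assume "\<exists>t. affine_near A t T x"
  then obtain W t where W: "openin (top_of_set reg) W" "x \<in> W" "\<forall>y\<in>W. fst (T y) = A \<bullet>\<^sub>c fst y + t"
    unfolding affine_near_def by blast
  show "affine_at surface A T x"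
    unfolding affine_at_def
  proof (intro ballI, clarify)
    fix U \<phi> V \<psi> assume ch: "(U, \<phi>) \<in> charts surface" "(V, \<psi>) \<in> charts surface" and xU: "x \<in> U" "T x \<in> V"
    have U: "openin (top_of_set reg) U" "\<phi> = fst" and V: "openin (top_of_set reg) V" "\<psi> = fst"
      using ch by (auto simp: charts_surface o_def)
    define W' where "W' = W \<inter> U \<inter> (reg \<inter> T -` V)"
    have "openin (top_of_set reg) W'"
      unfolding W'_def
      by (rule openin_Int[OF openin_Int[OF W(1) U(1)] continuous_openin_preimage[OF T V(1)]])
    hence "openin (top_of_set U) W'"
      using openin_imp_subset[OF U(1)] by (intro openin_subset_trans[of reg W' U]) (auto simp: W'_def)
    moreover have "x \<in> W'" "T ` W' \<subseteq> V" "\<forall>y\<in>W'. \<psi> (T y) = A \<bullet>\<^sub>c \<phi> y + t"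
      using W xU x U V by (auto simp: W'_def)
    ultimately show "\<exists>W t. openin (top_of_set U) W \<and> x \<in> W \<and> T ` W \<subseteq> V \<and> (\<forall>y\<in>W. \<psi> (T y) = A \<bullet>\<^sub>c \<phi> y + t)"
      by blast
  qed
qed

lemma affine_near_unique:
  assumes "affine_near A s T x" "affine_near B t T x"
  shows "A = B \<and> s = t"
proof -
  obtain W1 W2 where W: "openin (top_of_set reg) W1" "x \<in> W1" "\<forall>y\<in>W1. fst (T y) = A \<bullet>\<^sub>c fst y + s"
    "openin (top_of_set reg) W2" "x \<in> W2" "\<forall>y\<in>W2. fst (T y) = B \<bullet>\<^sub>c fst y + t"
    using assms unfolding affine_near_def by blast
  have "A = B"
  proof (rule act_eq_on_open_imp_eq)
    show "open (fst ` (W1 \<inter> W2))" using W by (intro open_fst_image openin_Int)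
    show "A \<bullet>\<^sub>c y + s = B \<bullet>\<^sub>c y + t" if "y \<in> fst ` (W1 \<inter> W2)" for y
      using that W(3,6) by force
  qed (use W in blast)
  moreover have "A \<bullet>\<^sub>c fst x + s = B \<bullet>\<^sub>c fst x + t" using W by metis
  ultimately show ?thesis by simp
qed

section \<open>From local to global linear parts\<close>

lemma reg_nonempty: "reg \<noteq> {}"
proof -
  obtain z where "f z \<noteq> 0"
    using eventually_nonzero[of 0] eventually_happens' by fastforce
  hence "(z, csqrt (f z)) \<in> reg" by (simp add: reg_def)
  thus ?thesis by blast
qed

lemma Aff_plusD:
  assumes "T \<in> Aff_plus surface"
  shows "continuous_on curve T" "T \<in> curve \<rightarrow> curve" "T ` cone_points surface = cone_points surface" "T \<in> reg \<rightarrow> reg"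
proof -
  obtain T' where T': "homeomorphism curve curve T T'"
    using assms by (auto simp: Aff_plus_def affine_diffeo_def points_surface)
  show cone: "T ` cone_points surface = cone_points surface"
    using assms by (auto simp: Aff_plus_def affine_diffeo_def)
  show "continuous_on curve T" "T \<in> curve \<rightarrow> curve"
    using T' by (auto simp: homeomorphism_def)
  have cc: "cone_points surface \<subseteq> curve" by (auto simp: cone_points_surface curve_def)
  have inj: "inj_on T curve" using T' by (metis homeomorphism_apply1 inj_on_inverseI)
  have "T ` reg = curve - cone_points surface"
    unfolding reg_eq using inj_on_image_set_diff[OF inj _ cc, of curve] cone homeomorphism_image1[OF T'] by auto
  thus "T \<in> reg \<rightarrow> reg" by (auto simp: reg_eq)
qed

text \<open>The pair (A, t) is locally constant on the connected set \<open>reg\<close>. Continuity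
  of \<open>T\<close> carries the formula to the cone points, where it tells how zeros move.\<close>

lemma Aff_plus_global:
  assumes T: "T \<in> Aff_plus surface"
  obtains A t where "0 < det A" "\<And>x. x \<in> curve \<Longrightarrow> fst (T x) = A \<bullet>\<^sub>c fst x + t" "differential surface T = A"
proof -
  note D = Aff_plusD[OF T]
  have contreg: "continuous_on reg T" using D(1) reg_subset_curve continuous_on_subset by blast
  have loc: "\<exists>A t. 0 < det A \<and> affine_near A t T x" if xr: "x \<in> reg" for x
  proof -
    obtain A where "A \<in> carrier GL_plus" "affine_at surface A T x"
      using T xr by (auto simp: Aff_plus_def orientation_preserving_def regular_points_surface)
    thus ?thesis using affine_at_iff[OF contreg D(4) xr] by (auto simp: GL_plus_def)
  qed
  obtain x0 where x0: "x0 \<in> reg" using reg_nonempty by blast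
  obtain A t where A: "0 < det A" "affine_near A t T x0" using loc[OF x0] by blast
  have near: "affine_near A t T x" if "x \<in> reg" for x
  proof (rule connected_induction_simple[where P = "affine_near A t T", OF connected_reg x0 that A(2)])
    fix a assume "a \<in> reg"
    then obtain B s where "affine_near B s T a" using loc by blast
    then obtain W where W: "openin (top_of_set reg) W" "a \<in> W" "\<forall>y\<in>W. fst (T y) = B \<bullet>\<^sub>c fst y + s"
      unfolding affine_near_def by blast
    have "affine_near B s T y" if "y \<in> W" for y
      using W that unfolding affine_near_def by blast
    hence "\<forall>x\<in>W. \<forall>y\<in>W. affine_near A t T x \<longrightarrow> affine_near A t T y"
      using affine_near_unique by blast
    with W show "\<exists>W. openin (top_of_set reg) W \<and> a \<in> W \<and> (\<forall>x\<in>W. \<forall>y\<in>W. affine_near A t T x \<longrightarrow> affine_near A t T y)"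
      by blast
  qed
  hence onreg: "fst (T x) = A \<bullet>\<^sub>c fst x + t" if "x \<in> reg" for x
    using that unfolding affine_near_def by blast
  have "fst (T x) = A \<bullet>\<^sub>c fst x + t" if x: "x \<in> curve" for x
  proof (cases "x \<in> reg")
    case False
    then obtain z where z: "x = (z, 0)" "f z = 0" using x by (auto simp: reg_def curve_def)
    \<comment> \<open>Jumps of \<open>csqrt\<close> do no harm in the limit: the modulus of the
      second coordinate tends to 0.\<close>
    define p where "p = (\<lambda>y. (y, csqrt (f y)))"
    have "((\<lambda>y. norm (csqrt (f y))) \<longlongrightarrow> sqrt (norm (f z))) (at z)"
      unfolding norm_csqrt using DERIV_isCont[OF DERIV_f[of z]] by (intro tendsto_intros) (simp add: isCont_def)
    hence "((\<lambda>y. csqrt (f y)) \<longlongrightarrow> 0) (at z)" by (simp add: z tendsto_norm_zero_cancel)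
    hence p: "(p \<longlongrightarrow> x) (at z)" unfolding p_def z by (intro tendsto_intros)
    have "((\<lambda>y. T (p y)) \<longlongrightarrow> T x) (at z)"
      using D(1) p x by (rule continuous_on_tendsto_compose) (simp add: p_def curve_def)
    hence "((\<lambda>y. fst (T (p y))) \<longlongrightarrow> fst (T x)) (at z)" by (rule tendsto_fst)
    moreover have "((\<lambda>y. fst (T (p y))) \<longlongrightarrow> A \<bullet>\<^sub>c z + t) (at z)"
    proof (rule Lim_transform_eventually)
      have "continuous_on UNIV (\<lambda>y. A \<bullet>\<^sub>c y + t)" by (intro continuous_intros)
      thus "((\<lambda>y. A \<bullet>\<^sub>c y + t) \<longlongrightarrow> A \<bullet>\<^sub>c z + t) (at z)" by (simp add: continuous_on_def)
      show "\<forall>\<^sub>F y in at z. A \<bullet>\<^sub>c y + t = fst (T (p y))"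
        using eventually_nonzero by eventually_elim (simp add: onreg p_def reg_def)
    qed
    ultimately have "fst (T x) = A \<bullet>\<^sub>c z + t" by (rule tendsto_unique[OF trivial_limit_at])
    thus ?thesis by (simp add: z)
  qed (use onreg in blast)
  moreover have "differential surface T = A"
    unfolding differential_def regular_points_surface
  proof (rule the_equality)
    show "\<forall>x\<in>reg. affine_at surface A T x" using affine_at_iff[OF contreg D(4)] near by blast
    show "B = A" if "\<forall>x\<in>reg. affine_at surface B T x" for B
      using that x0 affine_at_iff[OF contreg D(4) x0] affine_near_unique[OF A(2)] by blast
  qed
  ultimately show ?thesis using that A(1) by blast
qed

section \<open>Necessary and sufficient conditions on linear parts\<close>

lemma Veech_groupD:
  assumes "A \<in> Veech_group surface"
  obtains t where "0 < det A" "\<And>z. z \<in> range zs \<Longrightarrow> A \<bullet>\<^sub>c z + t \<in> range zs"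
proof -
  obtain T where T: "T \<in> Aff_plus surface" "A = differential surface T"
    using assms by (auto simp: Veech_group_def)
  obtain t where t: "0 < det A" "\<And>x. x \<in> curve \<Longrightarrow> fst (T x) = A \<bullet>\<^sub>c fst x + t"
    by (rule Aff_plus_global[OF T(1)]) (use T(2) in metis)
  have "A \<bullet>\<^sub>c z + t \<in> range zs" if "z \<in> range zs" for z
  proof -
    have "(z, 0) \<in> cone_points surface" using that by (auto simp: cone_points_surface zero_iff)
    hence "T (z, 0) \<in> cone_points surface" using Aff_plusD(3)[OF T(1)] by blast
    hence "f (fst (T (z, 0))) = 0" by (auto simp: cone_points_surface)
    moreover have "(z, 0) \<in> curve" using that zero_iff by (simp add: curve_def)
    ultimately show ?thesis using t(2) by (simp add: zero_iff)
  qed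
  with t(1) that show ?thesis by blast
qed

text \<open>The factor \<open>u\<close> is controlled only off the zeros; over a zero the equation
  of the curve forces the value 0.\<close>

definition lift :: "real^2^2 \<Rightarrow> (complex \<Rightarrow> complex) \<Rightarrow> complex \<times> complex \<Rightarrow> complex \<times> complex" where
  "lift A u x = (A \<bullet>\<^sub>c fst x, if f (fst x) = 0 then 0 else u (fst x) * snd x)"

text \<open>At a branch point, continuity comes from the modulus of the second coordinate, the root
  of |f (A z)|, so no limit of \<open>u\<close> is required there.\<close>

lemma
  assumes inv: "\<And>z. f (A \<bullet>\<^sub>c z) = 0 \<longleftrightarrow> f z = 0"
    and u: "continuous_on {z. f z \<noteq> 0} u" "\<And>z. f z \<noteq> 0 \<Longrightarrow> (u z)\<^sup>2 * f z = f (A \<bullet>\<^sub>c z)"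
  shows lift_curve: "lift A u \<in> curve \<rightarrow> curve" and continuous_on_lift: "continuous_on curve (lift A u)"
proof -
  show im: "lift A u \<in> curve \<rightarrow> curve"
    using u(2) inv by (auto simp: lift_def curve_def power_mult_distrib)
  have "((\<lambda>x. snd (lift A u x)) \<longlongrightarrow> snd (lift A u x)) (at x within curve)" if x: "x \<in> curve" for x
  proof (cases "f (fst x) = 0")
    case True
    have norm_lift: "norm (snd (lift A u y)) = sqrt (norm (f (A \<bullet>\<^sub>c fst y)))" if "y \<in> curve" for y
    proof -
      have "(snd (lift A u y))\<^sup>2 = f (A \<bullet>\<^sub>c fst y)"
        using im that by (force simp: curve_def lift_def)
      thus ?thesis by (metis norm_ge_zero norm_power real_sqrt_unique)
    qed
    have "continuous_on curve (\<lambda>y. sqrt (norm (f (A \<bullet>\<^sub>c fst y))))"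
      by (intro continuous_intros continuous_on_compose2[OF continuous_on_f[of UNIV]]) auto
    hence "((\<lambda>y. sqrt (norm (f (A \<bullet>\<^sub>c fst y)))) \<longlongrightarrow> sqrt (norm (f (A \<bullet>\<^sub>c fst x)))) (at x within curve)"
      using x by (simp add: continuous_on_def)
    moreover have "f (A \<bullet>\<^sub>c fst x) = 0" using True inv by simp
    ultimately have "((\<lambda>y. sqrt (norm (f (A \<bullet>\<^sub>c fst y)))) \<longlongrightarrow> 0) (at x within curve)" by simp
    hence "((\<lambda>y. norm (snd (lift A u y))) \<longlongrightarrow> 0) (at x within curve)"
      by (rule Lim_transform_eventually) (simp add: eventually_at_filter norm_lift)
    thus ?thesis using True by (simp add: lift_def tendsto_norm_zero_cancel)
  next
    case False
    have "isCont u (fst x)" using u(1) False by (rule continuous_on_nonzerosD)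
    hence "((\<lambda>y. u (fst y) * snd y) \<longlongrightarrow> u (fst x) * snd x) (at x within curve)"
      by (intro tendsto_intros isCont_tendsto_compose[of _ u])
    moreover have "open {y :: complex \<times> complex. f (fst y) \<noteq> 0}"
      by (intro open_Collect_neq continuous_on_compose2[OF continuous_on_f[of UNIV]] continuous_intros) auto
    hence "\<forall>\<^sub>F y in at x within curve. f (fst y) \<noteq> 0"
      using False by (metis (mono_tags, lifting) eventually_at_topological mem_Collect_eq)
    hence "\<forall>\<^sub>F y in at x within curve. u (fst y) * snd y = snd (lift A u y)"
      by eventually_elim (simp add: lift_def)
    ultimately have "((\<lambda>y. snd (lift A u y)) \<longlongrightarrow> u (fst x) * snd x) (at x within curve)"
      by (rule Lim_transform_eventually)
    thus ?thesis using False by (simp add: lift_def)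
  qed
  hence "continuous_on curve (\<lambda>x. snd (lift A u x))" by (simp add: continuous_on_def)
  hence "continuous_on curve (\<lambda>x. (A \<bullet>\<^sub>c fst x, snd (lift A u x)))"
    by (intro continuous_on_Pair continuous_on_act continuous_on_fst continuous_on_id)
  also have "(\<lambda>x. (A \<bullet>\<^sub>c fst x, snd (lift A u x))) = lift A u" by (auto simp: lift_def)
  finally show "continuous_on curve (lift A u)" .
qed

lemma Veech_groupI:
  assumes A: "0 < det A" "A ** B = mat 1" "B ** A = mat 1"
    and inv: "\<And>z. A \<bullet>\<^sub>c z \<in> range zs \<longleftrightarrow> z \<in> range zs"
  shows "A \<in> Veech_group surface"
proof -
  have AB: "A \<bullet>\<^sub>c (B \<bullet>\<^sub>c z) = z" "B \<bullet>\<^sub>c (A \<bullet>\<^sub>c z) = z" for z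
    using A(2,3) by (simp_all flip: act_mult)
  have fA: "f (A \<bullet>\<^sub>c z) = 0 \<longleftrightarrow> f z = 0" for z using inv by (simp add: zero_iff)
  have fB: "f (B \<bullet>\<^sub>c z) = 0 \<longleftrightarrow> f z = 0" for z using fA[of "B \<bullet>\<^sub>c z"] by (simp add: AB)
  obtain u where u: "continuous_on {z. f z \<noteq> 0} u" "\<And>z. f z \<noteq> 0 \<Longrightarrow> (u z)\<^sup>2 * f z = f (A \<bullet>\<^sub>c z)"
    using act_lift_factor[OF A(1) fA] by blast
  have u0: "u z \<noteq> 0" if "f z \<noteq> 0" for z using u(2)[OF that] fA[of z] that by auto
  \<comment> \<open>A factor chosen independently for \<open>B\<close> could give the inverse
    composed with the sheet exchange; this one makes the two lifts exactly inverse.\<close>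
  define u' where "u' = (\<lambda>z. 1 / u (B \<bullet>\<^sub>c z))"
  have cu': "continuous_on {z. f z \<noteq> 0} u'"
    unfolding u'_def using u0
    by (intro continuous_intros continuous_on_compose2[OF u(1)]) (auto simp: fB)
  have u': "(u' z)\<^sup>2 * f z = f (B \<bullet>\<^sub>c z)" if "f z \<noteq> 0" for z
    using u(2)[of "B \<bullet>\<^sub>c z"] u0[of "B \<bullet>\<^sub>c z"] that by (simp add: u'_def AB fB field_simps)
  define T where "T = lift A u"
  have hom: "homeomorphism curve curve T (lift B u')"
    unfolding T_def
  proof (rule homeomorphismI)
    show "lift A u ` curve \<subseteq> curve" "lift B u' ` curve \<subseteq> curve"
      using lift_curve[OF fA u] lift_curve[OF fB cu' u'] by blast+
    show "lift B u' (lift A u x) = x" if "x \<in> curve" for x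
      using that u0 by (cases x) (auto simp: lift_def AB fA fB u'_def curve_def)
    show "lift A u (lift B u' x) = x" if "x \<in> curve" for x
      using that u0 by (cases x) (auto simp: lift_def AB fA fB u'_def curve_def)
    show "continuous_on curve (lift A u)" using fA u by (rule continuous_on_lift)
    show "continuous_on curve (lift B u')" using fB cu' u' by (rule continuous_on_lift)
  qed
  have "T ` cone_points surface = cone_points surface"
  proof -
    have T0: "T (z, 0) = (A \<bullet>\<^sub>c z, 0)" for z by (simp add: T_def lift_def)
    show ?thesis
    proof (intro equalityI subsetI)
      fix x assume "x \<in> cone_points surface"
      then obtain z where x: "x = (z, 0)" "f z = 0" by (auto simp: cone_points_surface)
      have "x = T (B \<bullet>\<^sub>c z, 0)" by (simp add: T0 AB x)
      moreover have "(B \<bullet>\<^sub>c z, 0) \<in> cone_points surface" by (simp add: cone_points_surface fB x)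
      ultimately show "x \<in> T ` cone_points surface" by (rule image_eqI)
    qed (auto simp: cone_points_surface T0 fA)
  qed
  moreover have Treg: "T \<in> reg \<rightarrow> reg"
    using u u0 fA by (auto simp: T_def lift_def reg_def power_mult_distrib)
  have contT: "continuous_on reg T"
    using homeomorphism_cont1[OF hom] reg_subset_curve continuous_on_subset by blast
  have near: "affine_near A 0 T x" if "x \<in> reg" for x
    unfolding affine_near_def using that by (intro exI[of _ reg]) (auto simp: T_def lift_def)
  hence "\<forall>x\<in>reg. affine_at surface A T x" using affine_at_iff[OF contT Treg] by blast
  moreover have "A \<in> GL" "A \<in> carrier GL_plus" using A(1) by (auto simp: GL_def GL_plus_def)
  ultimately have T: "T \<in> Aff_plus surface"
    unfolding Aff_plus_def affine_diffeo_def orientation_preserving_def points_surface regular_points_surface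
    using hom by blast
  \<comment> \<open>\<open>differential\<close> is a definite description, so its value is taken
    from the global result and then compared with \<open>A\<close> near one point.\<close>
  obtain C t where C: "\<And>x. x \<in> curve \<Longrightarrow> fst (T x) = C \<bullet>\<^sub>c fst x + t" "differential surface T = C"
    using Aff_plus_global[OF T] by metis
  obtain x0 where x0: "x0 \<in> reg" using reg_nonempty by blast
  have "affine_near C t T x0"
    unfolding affine_near_def using x0 C(1) reg_subset_curve by (intro exI[of _ reg]) auto
  with near[OF x0] have "A = C" using affine_near_unique by blast
  with C(2) T show ?thesis by (auto simp: Veech_group_def)
qed

end

section \<open>The Veech group\<close>

theorem mainTheorem12:
  fixes G :: "(real^2^2) set"
  assumes "subgroup G GL_plus"
    and "finite G"
    and "\<forall>A\<in>G. \<not> contracting A"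
  shows "\<exists>n zs f. n \<ge> 2 \<and> weierstrass_map zs f \<and>
           Veech_group (superelliptic_surface n zs f) = G"
proof -
  have pos: "\<forall>A\<in>G. 0 < det A" using GL_plus_subgroupD(1)[OF assms(1)] by blast
  obtain zs where zs: "inj zs" "range zs = zero_set G" "filterlim (\<lambda>k. norm (zs k)) at_top sequentially"
    using discrete_enumeration[OF infinite_zero_set[OF assms(1)] finite_zero_set_cball[OF assms(2) pos]] by metis
  have "0 \<notin> range zs" using zero_notin_zero_set[OF pos] zs(2) by simp
  then obtain f where f: "weierstrass_map zs f" "f holomorphic_on UNIV" "\<And>z. f z = 0 \<longleftrightarrow> z \<in> range zs"
    "\<And>z. f z = 0 \<Longrightarrow> deriv f z \<noteq> 0"
    using weierstrass_map_exists[OF zs(1,3)] by metis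
  interpret simple_zeros zs f by standard (rule f)+
  have "A \<in> G" if "A \<in> Veech_group (superelliptic_surface 2 zs f)" for A
    using Veech_groupD[OF that] zero_set_rigid[OF assms(1,2)] unfolding zs(2) by metis
  moreover have "A \<in> Veech_group (superelliptic_surface 2 zs f)" if A: "A \<in> G" for A
  proof -
    obtain B where "A ** B = mat 1" "B ** A = mat 1"
      by (rule GL_plus_subgroup_inverse[OF assms(1) A])
    thus ?thesis using pos A act_zero_set[OF assms(1) A] by (intro Veech_groupI) (auto simp: zs(2))
  qed
  ultimately have "Veech_group (superelliptic_surface 2 zs f) = G" by blast
  with f(1) show ?thesis by blast
qed

end
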